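(* Let $p_n\in[0,1]$ be such that $p_n\to0$ and $n p_n/\ln n\to\infty$ as $n\to\infty$ (subcritical regime). Let $f_{n,1}^\downarrow$ be the size (number of vertices) of the largest fireproof subtree after the fire dynamics with parameter $p_n$ on a random recursive tree $\mathsf{T}_n$ with $n$ vertices. Then the sequence of random variables $(p_n f_{n,1}^\downarrow,\ n\ge1)$ is tight.
   Context: Write $[n]=\{1,\dots,n\}$. A tree on the vertex set $[n]$ is called recursive if, when rooted at $1$, the sequence of vertices along any branch from the root to a leaf is increasing. There are $(n-1)!$ such trees; the random recursive tree $\mathsf{T}_n$ is one of them picked uniformly at random. Fire dynamics with parameter $p_n$ on a tree with $n$ vertices: initially every edge is flammable. The edges are considered successively in a uniform random order; an edge which has already burnt is not subject to the dynamics any more and is skipped. Otherwise, independently of everything else, the edge becomes fireproof with probability $1-p_n$ or is set on fire with probability $p_n$; in the latter case the edge burns, sets on fire its flammable neighbouring edges, and the fire propagates instantly, stopped only by fireproof edges (so that the whole connected set of flammable edges containing it burns). The dynamics continue until all edges are either burnt or fireproof. A vertex is called fireproof if all its adjacent edges are fireproof, and burnt otherwise. The fireproof edges with at least one burnt extremity are then discarded; the connected components of the resulting forest are either composed of fireproof vertices (the fireproof subtrees) or of burnt vertices (the burnt subtrees). The size of the largest fireproof subtree is $0$ if there is no fireproof vertex. *)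

theory Defs
  imports "HOL-Probability.Probability" "HOL-Combinatorics.Multiset_Permutations"
begin

text \<open>
  A finite simple graph is given by a vertex set and a set of edges, each edge being the
  two-element set of its extremities.
\<close>

definition graph_path :: "'a set set \<Rightarrow> 'a list \<Rightarrow> bool" where
  "graph_path E xs \<longleftrightarrow> xs \<noteq> [] \<and> distinct xs \<and> successively (\<lambda>u v. {u, v} \<in> E) xs"

definition graph_cycle :: "'a set set \<Rightarrow> 'a list \<Rightarrow> bool" where
  "graph_cycle E xs \<longleftrightarrow> graph_path E xs \<and> 3 \<le> length xs \<and> {last xs, hd xs} \<in> E"

definition linked :: "'a set set \<Rightarrow> ('a \<times> 'a) set" where
  "linked E = {(u, v). {u, v} \<in> E}\<^sup>*"

definition graph_components :: "'a set \<Rightarrow> 'a set set \<Rightarrow> 'a set set" where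
  "graph_components V E = {{v \<in> V. (u, v) \<in> linked E} | u. u \<in> V}"

definition is_tree :: "'a set \<Rightarrow> 'a set set \<Rightarrow> bool" where
  "is_tree V E \<longleftrightarrow>
     V \<noteq> {} \<and> E \<subseteq> {{u, v} | u v. u \<in> V \<and> v \<in> V \<and> u \<noteq> v} \<and>
     (\<forall>u\<in>V. \<forall>v\<in>V. (u, v) \<in> linked E) \<and> (\<nexists>xs. graph_cycle E xs)"

text \<open>
  The bound \<open>\<le> 1\<close> instead of \<open>= 1\<close> makes the single vertex of a one-vertex tree a leaf. A root
  of degree one also counts, but its branch is the one-element list, which is always increasing.
\<close>

definition leaf :: "'a set set \<Rightarrow> 'a \<Rightarrow> bool" where
  "leaf E v \<longleftrightarrow> card {e \<in> E. v \<in> e} \<le> 1"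

definition recursive_trees :: "nat \<Rightarrow> nat set set set" where
  "recursive_trees n = {E. is_tree {1..n} E \<and>
     (\<forall>xs. graph_path E xs \<and> hd xs = 1 \<and> leaf E (last xs) \<longrightarrow> sorted_wrt (<) xs)}"

lemma finite_recursive_trees: "finite (recursive_trees n)"
proof (rule finite_subset)
  show "recursive_trees n \<subseteq> Pow (Pow {1..n})"
    by (fastforce simp: recursive_trees_def is_tree_def)
qed simp

text \<open>The star centred at the root is recursive, so the uniform choice below is well defined.\<close>

lemma recursive_trees_nonempty:
  assumes "n \<ge> 1"
  shows "recursive_trees n \<noteq> {}"
proof -
  define E where "E = {{1::nat, k} | k. k \<in> {2..n}}"
  have centre: "1 \<in> e" if "e \<in> E" for e
    using that by (auto simp: E_def)
  have short: "False" if "graph_path E (a # b # c # d # xs)" for a b c d xs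
    using that centre[of "{a, b}"] centre[of "{c, d}"] by (auto simp: graph_path_def)
  have acyclic: "\<not> graph_cycle E xs" for xs
  proof
    assume xs: "graph_cycle E xs"
    then obtain a b c ys where eq: "xs = a # b # c # ys"
      by (auto simp: graph_cycle_def numeral_3_eq_3 Suc_le_length_iff)
    show False
    proof (cases ys)
      case Nil
      then show False
        using xs eq centre[of "{a, b}"] centre[of "{b, c}"] centre[of "{c, a}"]
        by (auto simp: graph_cycle_def graph_path_def)
    next
      case (Cons d zs)
      then show False
        using xs eq short by (auto simp: graph_cycle_def)
    qed
  qed
  have to: "(1, v) \<in> linked E" if "v \<in> {1..n}" for v
    using that by (cases "v = 1") (auto simp: linked_def E_def intro!: r_into_rtrancl)
  have "(u, 1) \<in> linked E" if "u \<in> {1..n}" for u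
    using that
    by (cases "u = 1") (auto simp: linked_def E_def insert_commute intro!: r_into_rtrancl)
  with to have conn: "(u, v) \<in> linked E" if "u \<in> {1..n}" "v \<in> {1..n}" for u v
    using that unfolding linked_def by (meson rtrancl_trans)
  have sub: "E \<subseteq> {{u, v} | u v. u \<in> {1..n} \<and> v \<in> {1..n} \<and> u \<noteq> v}"
  proof
    fix e assume "e \<in> E"
    then obtain k where "e = {1, k}" "k \<in> {2..n}"
      by (auto simp: E_def)
    then show "e \<in> {{u, v} | u v. u \<in> {1..n} \<and> v \<in> {1..n} \<and> u \<noteq> v}"
      by (intro CollectI exI[of _ 1] exI[of _ k]) auto
  qed
  have incr: "sorted_wrt (<) xs" if xs: "graph_path E xs" "hd xs = 1" for xs
  proof (cases xs)
    case (Cons a ys)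
    show ?thesis
    proof (cases ys)
      case (Cons b zs)
      with xs \<open>xs = a # ys\<close> have "a = 1" "{1, b} \<in> E" "b \<noteq> 1"
        by (auto simp: graph_path_def)
      then have "1 < b"
        by (auto simp: E_def doubleton_eq_iff)
      moreover have "zs = []"
      proof (cases zs)
        case (Cons c ws)
        then show ?thesis
          using xs \<open>xs = a # ys\<close> \<open>ys = b # zs\<close> centre[of "{b, c}"]
          by (auto simp: graph_path_def)
      qed
      ultimately show ?thesis
        using \<open>xs = a # ys\<close> \<open>ys = b # zs\<close> \<open>a = 1\<close> by simp
    qed (simp add: Cons)
  qed simp
  have "E \<in> recursive_trees n"
    using assms acyclic conn sub incr by (auto simp: recursive_trees_def is_tree_def)
  then show ?thesis by blast
qed

text \<open>
  The set of edges that burn when \<open>e\<close> is set on fire and the flammable edges are \<open>A\<close>.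
\<close>

inductive_set fire_spread :: "'a set set \<Rightarrow> 'a set \<Rightarrow> 'a set set"
  for A :: "'a set set" and e :: "'a set" where
  start: "e \<in> fire_spread A e"
| spread: "f \<in> fire_spread A e \<Longrightarrow> g \<in> A \<Longrightarrow> f \<inter> g \<noteq> {} \<Longrightarrow> g \<in> fire_spread A e"

text \<open>
  The list is the order in which the remaining edges are considered, \<open>A\<close> is the set of
  flammable edges and \<open>F\<close> the set of fireproof edges; all other edges are burnt. The result
  is the law of the final set of fireproof edges. As every edge is considered only once, an
  edge that is not flammable when its turn comes has already burnt.
\<close>

primrec fire_dynamics ::
    "real \<Rightarrow> 'a set list \<Rightarrow> 'a set set \<Rightarrow> 'a set set \<Rightarrow> 'a set set pmf" where
  "fire_dynamics p [] A F = return_pmf F"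
| "fire_dynamics p (e # es) A F =
     (if e \<in> A then
        do {
          fire \<leftarrow> bernoulli_pmf p;
          if fire then fire_dynamics p es (A - fire_spread A e) F
          else fire_dynamics p es (A - {e}) (insert e F)
        }
      else fire_dynamics p es A F)"

text \<open>In the following, \<open>F\<close> is the final set of fireproof edges.\<close>

definition fireproof_vertices :: "'a set \<Rightarrow> 'a set set \<Rightarrow> 'a set set \<Rightarrow> 'a set" where
  "fireproof_vertices V E F = {v \<in> V. \<forall>e\<in>E. v \<in> e \<longrightarrow> e \<in> F}"

definition final_forest :: "'a set \<Rightarrow> 'a set set \<Rightarrow> 'a set set \<Rightarrow> 'a set set" where
  "final_forest V E F = E - {e \<in> F. \<not> e \<subseteq> fireproof_vertices V E F}"

definition fireproof_subtrees :: "'a set \<Rightarrow> 'a set set \<Rightarrow> 'a set set \<Rightarrow> 'a set set" where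
  "fireproof_subtrees V E F =
     {C \<in> graph_components V (final_forest V E F). C \<subseteq> fireproof_vertices V E F}"

definition largest_fireproof_size :: "'a set \<Rightarrow> 'a set set \<Rightarrow> 'a set set \<Rightarrow> nat" where
  "largest_fireproof_size V E F = Max (insert 0 (card ` fireproof_subtrees V E F))"

definition rrt_largest_fireproof :: "nat \<Rightarrow> real \<Rightarrow> nat pmf" where
  "rrt_largest_fireproof n p =
     do {
       E \<leftarrow> pmf_of_set (recursive_trees n);
       es \<leftarrow> pmf_of_set (permutations_of_set E);
       F \<leftarrow> fire_dynamics p es E {};
       return_pmf (largest_fireproof_size {1..n} E F)
     }"

end

theory Submission
  imports Defs
begin

text \<open>
  As long as the flammable component of the root has not burnt, it consists of the edges with no
  already considered edge above them. Consider the first \<open>M \<approx> A / p\<close> edges. On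
  average at most of order \<open>M\<^sup>2 ln n / n\<close> of them have an earlier edge above them, which is
  \<open>o(M)\<close> since \<open>n p / ln n \<rightarrow> \<infinity>\<close>; each of the other ones sets the root component on fire
  with probability \<open>p\<close>, so that this component burns during the first \<open>M\<close> steps except with
  probability about \<open>exp (- A / 2)\<close>. Once it has burnt, every fireproof subtree lies in the
  subtree hanging below one of these \<open>M\<close> edges. On average at most \<open>5 n / m\<close> of the subtrees of a
  random recursive tree have size at least \<open>m\<close>, so one of the \<open>M\<close> chosen ones does with
  probability of order \<open>M / m\<close>, which is small for \<open>m = K / p\<close> with \<open>K\<close> large.
\<close>

section \<open>Recursive trees as parent functions\<close>

text \<open>Only the parent of each vertex other than the root is recorded; extensionality fixes the
  values outside \<open>{2..n}\<close>, so that each recursive tree comes from exactly one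
  map.\<close>

definition parent_maps :: "nat \<Rightarrow> (nat \<Rightarrow> nat) set" where
  "parent_maps n = (\<Pi>\<^sub>E k\<in>{2..n}. {1..<k})"

text \<open>Every edge is named by its lower end \<open>k\<close>, so the edges of a tree are
  indexed by \<open>{2..n}\<close> and sets of edges become sets of numbers.\<close>

definition edge :: "(nat \<Rightarrow> nat) \<Rightarrow> nat \<Rightarrow> nat set" where
  "edge f k = {f k, k}"

text \<open>This is the reflexive ancestor relation. The guard \<open>f u < u\<close> makes every
  step of the climb decrease, whatever \<open>f\<close> is; a parent map satisfies it on
  \<open>{2..n}\<close>.\<close>

inductive desc :: "(nat \<Rightarrow> nat) \<Rightarrow> nat \<Rightarrow> nat \<Rightarrow> bool" for f v where
  refl: "desc f v v"
| step: "desc f v (f u) \<Longrightarrow> f u < u \<Longrightarrow> desc f v u"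

definition subtree :: "(nat \<Rightarrow> nat) \<Rightarrow> nat \<Rightarrow> nat \<Rightarrow> nat set" where
  "subtree f n v = {u \<in> {1..n}. desc f v u}"

lemma finite_parent_maps: "finite (parent_maps n)"
  by (simp add: parent_maps_def finite_PiE)

lemma parent_maps_nonempty: "parent_maps n \<noteq> {}"
  by (auto simp: parent_maps_def PiE_eq_empty_iff)

lemma parent_in:
  assumes "f \<in> parent_maps n" "k \<in> {2..n}"
  shows "f k \<in> {1..<k}"
  using assms by (auto simp: parent_maps_def PiE_def Pi_def)

lemma desc_le: "desc f v u \<Longrightarrow> v \<le> u"
  by (induction rule: desc.induct) auto

lemma desc_trans: "desc f v u \<Longrightarrow> desc f u w \<Longrightarrow> desc f v w"
  by (rotate_tac, induction rule: desc.induct) (auto intro: desc.intros)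

lemma desc_iff: "v < u \<Longrightarrow> desc f v u \<longleftrightarrow> f u < u \<and> desc f v (f u)"
  by (subst desc.simps) auto

text \<open>Climbing from \<open>u\<close> reads \<open>f\<close> only at arguments up to
  \<open>u\<close>, so attaching a later vertex does not change ancestry among the earlier
  ones.\<close>

lemma desc_fun_upd: "u < k \<Longrightarrow> desc (f(k := y)) v u \<longleftrightarrow> desc f v u"
proof (induction u rule: less_induct)
  case (less u)
  have "desc (f(k := y)) v u \<longleftrightarrow> desc f v u" if "v < u"
  proof -
    have "f u < u \<Longrightarrow> desc (f(k := y)) v (f u) \<longleftrightarrow> desc f v (f u)"
      using less.prems by (intro less.IH) auto
    with less.prems show ?thesis by (simp add: desc_iff[OF that] cong: conj_cong)
  qed
  moreover have "desc g v u \<longleftrightarrow> v = u" if "\<not> v < u" for g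
    using that desc_le[of g v u] by (auto intro: desc.refl)
  ultimately show ?case by blast
qed

lemma edge_inj:
  assumes "f \<in> parent_maps n" "g \<in> parent_maps n" "j \<in> {2..n}" "k \<in> {2..n}" "edge f j = edge g k"
  shows "j = k" "f j = g k"
proof -
  have "f j < j" "g k < k" using parent_in[OF assms(1,3)] parent_in[OF assms(2,4)] by auto
  with assms(5) show "j = k" "f j = g k" by (auto simp: edge_def doubleton_eq_iff)
qed

lemma inj_on_edge: "f \<in> parent_maps n \<Longrightarrow> inj_on (edge f) {2..n}"
  by (intro inj_onI) (rule edge_inj)

lemma inj_on_edges: "inj_on (\<lambda>f. edge f ` {2..n}) (parent_maps n)"
proof (rule inj_onI)
  fix f g assume f: "f \<in> parent_maps n" and g: "g \<in> parent_maps n"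
    and eq: "edge f ` {2..n} = edge g ` {2..n}"
  have "f k = g k" if k: "k \<in> {2..n}" for k
  proof -
    from k eq obtain j where j: "j \<in> {2..n}" "edge f k = edge g j" by blast
    then show ?thesis using edge_inj[OF f g k j(1)] by auto
  qed
  then show "f = g" using f g unfolding parent_maps_def by (intro PiE_ext) auto
qed

lemma edge_endpoint:
  assumes "f \<in> parent_maps n" "{u, v} \<in> edge f ` {2..n}" "u < v"
  shows "v \<in> {2..n}" "f v = u"
proof -
  from assms obtain k where k: "k \<in> {2..n}" "{u, v} = {f k, k}" by (auto simp: edge_def)
  with parent_in[OF assms(1) k(1)] assms(3) have "v = k" "u = f k"
    by (auto simp: doubleton_eq_iff)
  with k show "v \<in> {2..n}" "f v = u" by auto
qed

section \<open>Correspondence between parent maps and recursive trees\<close>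

lemma linked_sym: "(u, v) \<in> linked E \<Longrightarrow> (v, u) \<in> linked E"
proof -
  have "sym {(u, v). {u, v} \<in> E}" by (auto simp: sym_def insert_commute)
  then have "sym (linked E)" unfolding linked_def by (rule sym_rtrancl)
  then show "(u, v) \<in> linked E \<Longrightarrow> (v, u) \<in> linked E" by (auto simp: sym_def)
qed

text \<open>A cycle has at least three vertices, so the cyclic predecessor and successor of a vertex
  are two different neighbours of it.\<close>

lemma graph_cycle_neighbours:
  assumes "graph_cycle E xs" "i < length xs"
  obtains a b where "a \<in> set xs" "b \<in> set xs" "a \<noteq> b" "a \<noteq> xs ! i" "b \<noteq> xs ! i"
    "{a, xs ! i} \<in> E" "{b, xs ! i} \<in> E"
proof -
  let ?n = "length xs"
  define j where "j = (if i = 0 then ?n - 1 else i - 1)"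
  define k where "k = (if i = ?n - 1 then 0 else i + 1)"
  from assms have n: "3 \<le> ?n" "distinct xs" "xs \<noteq> []" "{last xs, hd xs} \<in> E"
    and suc: "\<And>i. Suc i < ?n \<Longrightarrow> {xs ! i, xs ! Suc i} \<in> E"
    by (auto simp: graph_cycle_def graph_path_def successively_conv_nth)
  have ends: "{xs ! (?n - 1), xs ! 0} \<in> E"
    using n by (simp add: last_conv_nth hd_conv_nth)
  have *: "j < ?n" "k < ?n" "j \<noteq> k" "j \<noteq> i" "k \<noteq> i"
    using n assms(2) by (auto simp: j_def k_def)
  have "{xs ! j, xs ! i} \<in> E"
    using ends suc[of "i - 1"] assms(2) by (auto simp: j_def)
  moreover have "{xs ! k, xs ! i} \<in> E"
    using ends suc[of i] assms(2) n by (auto simp: k_def insert_commute)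
  moreover have "xs ! j \<noteq> xs ! k" "xs ! j \<noteq> xs ! i" "xs ! k \<noteq> xs ! i"
    using * assms(2) n by (auto simp: nth_eq_iff_index_eq)
  ultimately show ?thesis using that * by (meson nth_mem)
qed

lemma edges_recursive_tree:
  assumes f: "f \<in> parent_maps n" and n: "n \<ge> 1"
  shows "edge f ` {2..n} \<in> recursive_trees n"
proof -
  let ?E = "edge f ` {2..n}"
  have sub: "?E \<subseteq> {{u, v} | u v. u \<in> {1..n} \<and> v \<in> {1..n} \<and> u \<noteq> v}"
  proof
    fix e assume "e \<in> ?E"
    then obtain k where k: "k \<in> {2..n}" "e = {f k, k}" by (auto simp: edge_def)
    with parent_in[OF f k(1)] show "e \<in> {{u, v} | u v. u \<in> {1..n} \<and> v \<in> {1..n} \<and> u \<noteq> v}"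
      by (intro CollectI exI[of _ "f k"] exI[of _ k]) auto
  qed
  have root: "(1, v) \<in> linked ?E" if "v \<in> {1..n}" for v
    using that
  proof (induction v rule: less_induct)
    case (less v)
    show ?case
    proof (cases "v = 1")
      case False
      then have v: "v \<in> {2..n}" using less.prems by auto
      from parent_in[OF f v] less have "(1, f v) \<in> linked ?E" by auto
      moreover have "{f v, v} \<in> ?E" using v by (auto simp: edge_def)
      ultimately show ?thesis unfolding linked_def by (simp add: rtrancl.rtrancl_into_rtrancl)
    qed (simp add: linked_def)
  qed
  then have conn: "(u, v) \<in> linked ?E" if "u \<in> {1..n}" "v \<in> {1..n}" for u v
    using that linked_sym[OF root[of u]] unfolding linked_def by (meson rtrancl_trans)
  \<comment> \<open>The largest vertex of a cycle would have two smaller neighbours, but its only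
    smaller neighbour is its parent.\<close>
  have acyclic: "\<not> graph_cycle ?E xs" for xs
  proof
    assume xs: "graph_cycle ?E xs"
    then have "xs \<noteq> []" by (auto simp: graph_cycle_def)
    then have "Max (set xs) \<in> set xs" by simp
    then obtain i where i: "i < length xs" "xs ! i = Max (set xs)" by (auto simp: in_set_conv_nth)
    from graph_cycle_neighbours[OF xs i(1)] obtain a b where
      ab: "a \<in> set xs" "b \<in> set xs" "a \<noteq> b" "a \<noteq> xs ! i" "b \<noteq> xs ! i"
      "{a, xs ! i} \<in> ?E" "{b, xs ! i} \<in> ?E" .
    have "a < xs ! i" "b < xs ! i" using ab i by (auto simp: order.not_eq_order_implies_strict)
    then show False using edge_endpoint[OF f] ab by metis
  qed
  have incr: "sorted_wrt (<) xs" if xs: "graph_path ?E xs" "hd xs = 1" for xs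
  proof -
    from xs have d: "distinct xs" "xs \<noteq> []"
      and suc: "\<And>i. Suc i < length xs \<Longrightarrow> {xs ! i, xs ! Suc i} \<in> ?E"
      by (auto simp: graph_path_def successively_conv_nth)
    \<comment> \<open>After an ascent the previous vertex is the parent of the current one, so a
      descent would have to return to it. The first step ascends because it leaves the smallest
      vertex.\<close>
    have "xs ! i < xs ! Suc i" if "Suc i < length xs" for i
      using that
    proof (induction i)
      case 0
      from suc[OF 0] sub have "xs ! Suc 0 \<in> {1..n}" by (auto simp: doubleton_eq_iff)
      moreover have "xs ! 0 = 1" using xs d by (simp add: hd_conv_nth)
      moreover have "xs ! 0 \<noteq> xs ! Suc 0" using d 0 by (simp add: nth_eq_iff_index_eq)
      ultimately show ?case by auto
    next
      case (Suc i)
      have lt: "xs ! i < xs ! Suc i" using Suc by simp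
      have "xs ! i \<noteq> xs ! Suc (Suc i)" "xs ! Suc i \<noteq> xs ! Suc (Suc i)"
        using d Suc.prems by (simp_all add: nth_eq_iff_index_eq)
      moreover have "f (xs ! Suc i) = xs ! i"
        using edge_endpoint(2)[OF f suc[of i] lt] Suc.prems by simp
      ultimately show ?case
        using edge_endpoint(2)[OF f, of "xs ! Suc (Suc i)" "xs ! Suc i"] suc[OF Suc.prems]
        by (metis insert_commute linorder_neqE_nat)
    qed
    then show ?thesis by (simp add: sorted_wrt_iff_nth_Suc_transp)
  qed
  show ?thesis
    using n sub conn acyclic incr unfolding recursive_trees_def is_tree_def by auto
qed

lemma linked_path:
  assumes "(u, v) \<in> linked E"
  obtains xs where "graph_path E xs" "hd xs = u" "last xs = v"
proof -
  have "\<exists>xs. graph_path E xs \<and> hd xs = u \<and> last xs = v"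
    using assms unfolding linked_def
  proof (induction rule: rtrancl_induct)
    case base
    show ?case by (intro exI[of _ "[u]"]) (auto simp: graph_path_def)
  next
    case (step y z)
    then obtain xs where xs: "graph_path E xs" "hd xs = u" "last xs = y" by blast
    show ?case
    proof (cases "z \<in> set xs")
      case False
      with xs step show ?thesis
        by (intro exI[of _ "xs @ [z]"])
          (auto simp: graph_path_def successively_append_iff)
    next
      case True
      then obtain ys zs where "xs = ys @ z # zs" by (meson split_list)
      with xs show ?thesis
        by (intro exI[of _ "ys @ [z]"])
          (auto simp: graph_path_def successively_append_iff hd_append split: if_splits)
    qed
  qed
  with that show ?thesis by blast
qed

text \<open>The definition only speaks of paths ending in a leaf: extend the path to a maximal one.\<close>

lemma recursive_tree_path_sorted:
  assumes E: "E \<in> recursive_trees n" and xs: "graph_path E xs" "hd xs = 1"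
  shows "sorted_wrt (<) xs"
proof -
  have tree: "is_tree {1..n} E" using E by (auto simp: recursive_trees_def)
  then have sub: "\<And>e. e \<in> E \<Longrightarrow> \<exists>u v. e = {u, v} \<and> u \<in> {1..n} \<and> v \<in> {1..n} \<and> u \<noteq> v"
    and acyclic: "\<And>xs. \<not> graph_cycle E xs" and ne: "1 \<in> {1..n}"
    by (auto simp: is_tree_def)
  have sub2: "u \<in> {1..n}" "v \<in> {1..n}" "u \<noteq> v" if "{u, v} \<in> E" for u v
    using sub[OF that] by (auto simp: doubleton_eq_iff)
  have finE: "finite E"
  proof (rule finite_subset)
    show "E \<subseteq> Pow {1..n}" using sub by fastforce
  qed simp
  have vert: "set xs \<subseteq> {1..n}" if "graph_path E xs" "hd xs = 1" for xs
  proof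
    fix x assume "x \<in> set xs"
    then obtain i where i: "i < length xs" "x = xs ! i" by (auto simp: in_set_conv_nth)
    show "x \<in> {1..n}"
    proof (cases i)
      case 0
      with i that ne show ?thesis by (auto simp: graph_path_def hd_conv_nth)
    next
      case (Suc j)
      with that i have "{xs ! j, x} \<in> E" by (auto simp: graph_path_def successively_conv_nth)
      then show ?thesis by (rule sub2)
    qed
  qed
  show ?thesis
    using xs
  \<comment> \<open>Extending the path lowers \<open>n - length xs\<close>, because a path from the
    root has at most \<open>n\<close> vertices.\<close>
  proof (induction "n - length xs" arbitrary: xs rule: less_induct)
    case less
    note xs = less.prems
    have d: "distinct xs" "xs \<noteq> []" and suc: "successively (\<lambda>u v. {u, v} \<in> E) xs"
      using xs by (auto simp: graph_path_def)
    show ?case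
    proof (cases "leaf E (last xs)")
      case True
      then show ?thesis using E xs by (auto simp: recursive_trees_def)
    next
      case False
      let ?v = "last xs"
      \<comment> \<open>The edge by which the path reaches its end. For a one-vertex path the
        truncated subtraction gives the singleton of \<open>?v\<close>, which is no edge.\<close>
      define prev where "prev = {xs ! (length xs - 2), ?v}"
      from False have "\<not> {e \<in> E. ?v \<in> e} \<subseteq> {prev}"
        unfolding leaf_def by (metis card_mono finite.emptyI finite_insert is_singletonI is_singleton_altdef)
      then obtain e where e: "e \<in> E" "?v \<in> e" "e \<noteq> prev" by auto
      with sub[OF e(1)] obtain w where w: "e = {?v, w}" "w \<noteq> ?v" by auto
      \<comment> \<open>Otherwise the edge back to \<open>w\<close> would close a cycle; the choice
        \<open>e \<noteq> prev\<close> rules out that \<open>w\<close> is the vertex just before the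
        end.\<close>
      have "w \<notin> set xs"
      proof
        assume "w \<in> set xs"
        then obtain ys zs where split: "xs = ys @ w # zs" by (meson split_list)
        have zs: "zs \<noteq> []" using split w by auto
        have "length zs \<noteq> 1"
        proof
          assume "length zs = 1"
          then obtain z where "zs = [z]" by (auto simp: length_Suc_conv)
          with split e(3) w show False by (auto simp: prev_def nth_append insert_commute)
        qed
        with zs have "length zs \<ge> 2" by (cases zs rule: list.exhaust) (auto simp: Suc_le_eq)
        moreover have "graph_path E (w # zs)"
          using d suc split by (auto simp: graph_path_def successively_append_iff)
        moreover have "{last (w # zs), hd (w # zs)} \<in> E" using e w split by auto
        ultimately have "graph_cycle E (w # zs)" by (auto simp: graph_cycle_def)
        with acyclic show False by blast
      qed
      then have path: "graph_path E (xs @ [w])" "hd (xs @ [w]) = 1"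
        using xs d e w by (auto simp: graph_path_def successively_append_iff)
      have "length (xs @ [w]) \<le> n"
        using vert[OF path] path(1) card_mono[of "{1..n}" "set (xs @ [w])"]
        unfolding graph_path_def by (metis card_atLeastAtMost diff_Suc_1 distinct_card finite_atLeastAtMost)
      then have "sorted_wrt (<) (xs @ [w])" using path by (intro less.hyps) auto
      then show ?thesis by (simp add: sorted_wrt_append)
    qed
  qed
qed

lemma recursive_tree_edges:
  assumes E: "E \<in> recursive_trees n"
  obtains f where "f \<in> parent_maps n" "E = edge f ` {2..n}"
proof -
  have tree: "is_tree {1..n} E" using E by (auto simp: recursive_trees_def)
  then have sub: "\<And>e. e \<in> E \<Longrightarrow> \<exists>u v. e = {u, v} \<and> u \<in> {1..n} \<and> v \<in> {1..n} \<and> u \<noteq> v"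
    and acyclic: "\<And>xs. \<not> graph_cycle E xs" and ne: "1 \<in> {1..n}"
    and conn: "\<And>u v. u \<in> {1..n} \<Longrightarrow> v \<in> {1..n} \<Longrightarrow> (u, v) \<in> linked E"
    by (auto simp: is_tree_def)
  have sub2: "u \<in> {1..n}" "v \<in> {1..n}" "u \<noteq> v" if "{u, v} \<in> E" for u v
    using sub[OF that] by (auto simp: doubleton_eq_iff)
  \<comment> \<open>The path from the root to \<open>k\<close> increases, so its last vertex but one
    is a smaller neighbour of \<open>k\<close>.\<close>
  have ex: "\<exists>u. u < k \<and> {u, k} \<in> E" if k: "k \<in> {2..n}" for k
  proof -
    have "(1, k) \<in> linked E" using conn ne k by auto
    then obtain xs where xs: "graph_path E xs" "hd xs = 1" "last xs = k" by (rule linked_path)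
    from xs obtain ys where ys: "xs = ys @ [k]" by (metis append_butlast_last_id graph_path_def)
    have "ys \<noteq> []" using ys xs k by auto
    then have "{last ys, k} \<in> E" using xs ys by (auto simp: graph_path_def successively_append_iff)
    moreover have "last ys < k"
      using recursive_tree_path_sorted[OF E xs(1,2)] ys \<open>ys \<noteq> []\<close> by (auto simp: sorted_wrt_append)
    ultimately show ?thesis by blast
  qed
  \<comment> \<open>Append \<open>k\<close> to the increasing path from the root to
    \<open>a\<close>. If \<open>b\<close> is not on this path, going on from \<open>k\<close> to
    \<open>b\<close> would be a descent on a path from the root; if \<open>b\<close> is on it, there
    is a cycle.\<close>
  have uniq: "a = b" if a: "a < k" "{a, k} \<in> E" and b: "b < k" "{b, k} \<in> E" for a b k
  proof (rule ccontr)
    assume "a \<noteq> b"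
    have "(1, a) \<in> linked E" using conn ne sub2[OF a(2)] by auto
    then obtain xs where xs: "graph_path E xs" "hd xs = 1" "last xs = a" by (rule linked_path)
    have srt: "sorted_wrt (<) xs" by (rule recursive_tree_path_sorted[OF E xs(1,2)])
    have nonempty: "xs \<noteq> []" using xs by (auto simp: graph_path_def)
    have le: "x \<le> a" if "x \<in> set xs" for x
      using srt that xs(3) nonempty
      by (cases xs rule: rev_cases) (auto simp: sorted_wrt_append)
    then have k: "k \<notin> set xs" using a(1) by fastforce
    have p: "graph_path E (xs @ [k])" using xs a k nonempty
      by (auto simp: graph_path_def successively_append_iff)
    show False
    proof (cases "b \<in> set xs")
      case False
      then have "graph_path E (xs @ [k, b])"
        using p xs b k a by (auto simp: graph_path_def successively_append_iff insert_commute)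
      then have "sorted_wrt (<) (xs @ [k, b])"
        using xs nonempty by (intro recursive_tree_path_sorted[OF E]) auto
      then show False using b by (auto simp: sorted_wrt_append)
    next
      case True
      then obtain ys zs where split: "xs = ys @ b # zs" by (meson split_list)
      have "zs \<noteq> []" using split xs \<open>a \<noteq> b\<close> by auto
      then have "graph_cycle E (b # zs @ [k])"
        using p split b by (cases zs) (auto simp: graph_cycle_def graph_path_def successively_append_iff insert_commute)
      then show False using acyclic by blast
    qed
  qed
  define f where "f = restrict (\<lambda>k. SOME u. u < k \<and> {u, k} \<in> E) {2..n}"
  have f: "f k < k" "{f k, k} \<in> E" if "k \<in> {2..n}" for k
    using someI_ex[OF ex[OF that]] that by (auto simp: f_def)
  have "f \<in> parent_maps n"
    unfolding parent_maps_def
  proof (rule PiE_I)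
    fix k assume k: "k \<in> {2..n}"
    show "f k \<in> {1..<k}" using f[OF k] sub2[OF f(2)[OF k]] by auto
  qed (auto simp: f_def)
  moreover have "E = edge f ` {2..n}"
  proof
    show "edge f ` {2..n} \<subseteq> E" using f by (auto simp: edge_def)
    show "E \<subseteq> edge f ` {2..n}"
    proof
      fix e assume e: "e \<in> E"
      from sub[OF e] obtain u v where uv: "e = {u, v}" "u < v"
        by (metis insert_commute linorder_neqE_nat)
      then have v: "v \<in> {2..n}" "{u, v} \<in> E" using sub2[of u v] e by auto
      then have "u = f v" using uniq[OF uv(2) v(2) f[OF v(1)]] by simp
      then show "e \<in> edge f ` {2..n}" using uv v by (auto simp: edge_def)
    qed
  qed
  ultimately show ?thesis using that by blast
qed

lemma recursive_trees_eq:
  "n \<ge> 1 \<Longrightarrow> recursive_trees n = (\<lambda>f. edge f ` {2..n}) ` parent_maps n"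
  by (blast intro: edges_recursive_tree elim: recursive_tree_edges)

lemma pmf_of_set_recursive_trees:
  assumes "n \<ge> 1"
  shows "pmf_of_set (recursive_trees n) = map_pmf (\<lambda>f. edge f ` {2..n}) (pmf_of_set (parent_maps n))"
  using map_pmf_of_set_inj[OF inj_on_edges parent_maps_nonempty finite_parent_maps]
    recursive_trees_eq[OF assms] by simp

section \<open>Sizes of subtrees\<close>

definition parent_mean :: "nat \<Rightarrow> ((nat \<Rightarrow> nat) \<Rightarrow> real) \<Rightarrow> real" where
  "parent_mean n h = (\<Sum>f\<in>parent_maps n. h f) / card (parent_maps n)"

lemma parent_mean_eq: "parent_mean n h = measure_pmf.expectation (pmf_of_set (parent_maps n)) h"
  by (simp add: parent_mean_def integral_pmf_of_set finite_parent_maps parent_maps_nonempty)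

lemma card_parent_maps_pos: "card (parent_maps n) > 0"
  by (simp add: card_gt_0_iff finite_parent_maps parent_maps_nonempty)

lemma parent_mean_mono:
  "(\<And>f. f \<in> parent_maps n \<Longrightarrow> g f \<le> h f) \<Longrightarrow> parent_mean n g \<le> parent_mean n h"
  unfolding parent_mean_def by (intro divide_right_mono sum_mono) auto

lemma parent_mean_cong:
  "(\<And>f. f \<in> parent_maps n \<Longrightarrow> g f = h f) \<Longrightarrow> parent_mean n g = parent_mean n h"
  unfolding parent_mean_def by simp

lemma parent_mean_const [simp]: "parent_mean n (\<lambda>_. c) = c"
  using card_parent_maps_pos[of n] by (simp add: parent_mean_def)

lemma parent_mean_cmult: "parent_mean n (\<lambda>f. c * h f) = c * parent_mean n h"
  by (simp add: parent_mean_def sum_distrib_left)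

lemma parent_mean_add: "parent_mean n (\<lambda>f. g f + h f) = parent_mean n g + parent_mean n h"
  by (simp add: parent_mean_def sum.distrib add_divide_distrib)

lemma parent_mean_sum: "parent_mean n (\<lambda>f. \<Sum>i\<in>I. h i f) = (\<Sum>i\<in>I. parent_mean n (h i))"
  unfolding parent_mean_def by (subst sum.swap) (simp add: sum_divide_distrib)

text \<open>Growth of the tree: a map in \<open>parent_maps (Suc n)\<close> is a map in
  \<open>parent_maps n\<close> together with the parent \<open>y\<close> of the new vertex.\<close>

lemma sum_parent_maps_Suc:
  assumes "n \<ge> 1"
  shows "(\<Sum>f\<in>parent_maps (Suc n). h f) = (\<Sum>g\<in>parent_maps n. \<Sum>y\<in>{1..n}. h (g(Suc n := y)))"
proof -
  have ins: "{2..Suc n} = insert (Suc n) {2..n}" and new: "Suc n \<notin> {2..n}" using assms by auto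
  have "parent_maps (Suc n) = (\<lambda>(y, g). g(Suc n := y)) ` ({1..n} \<times> parent_maps n)"
    unfolding parent_maps_def ins PiE_insert_eq by (simp add: atLeastLessThanSuc_atLeastAtMost)
  moreover have "inj_on (\<lambda>(y, g). g(Suc n := y)) ({1..n} \<times> parent_maps n)"
    using inj_combinator[OF new, of "\<lambda>k. {1..<k}"]
    by (simp add: parent_maps_def atLeastLessThanSuc_atLeastAtMost)
  ultimately have "(\<Sum>f\<in>parent_maps (Suc n). h f)
      = (\<Sum>(y, g)\<in>{1..n} \<times> parent_maps n. h (g(Suc n := y)))"
    by (simp add: sum.reindex case_prod_unfold)
  also have "\<dots> = (\<Sum>g\<in>parent_maps n. \<Sum>y\<in>{1..n}. h (g(Suc n := y)))"
    by (subst sum.swap) (simp add: sum.cartesian_product[symmetric])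
  finally show ?thesis .
qed

lemma parent_mean_Suc:
  assumes "n \<ge> 1"
  shows "parent_mean (Suc n) h = parent_mean n (\<lambda>g. (\<Sum>y\<in>{1..n}. h (g(Suc n := y))) / n)"
proof -
  have "real (card (parent_maps (Suc n))) = (\<Sum>f\<in>parent_maps (Suc n). 1)" by simp
  also have "\<dots> = n * card (parent_maps n)" by (subst sum_parent_maps_Suc[OF assms]) simp
  finally show ?thesis
    unfolding parent_mean_def
    by (simp add: sum_parent_maps_Suc[OF assms] sum_divide_distrib[symmetric])
qed

section \<open>Growth of a single subtree\<close>

lemma finite_subtree [simp]: "finite (subtree f n v)"
  by (simp add: subtree_def)

lemma subtree_fresh: "v \<ge> 1 \<Longrightarrow> subtree f v v = {v}"
  by (auto simp: subtree_def desc.refl dest: desc_le)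

lemma subtree_extend:
  assumes "v \<le> n" "y \<in> {1..n}"
  shows "card (subtree (g(Suc n := y)) (Suc n) v)
    = card (subtree g n v) + (if y \<in> subtree g n v then 1 else 0)"
proof -
  have new: "desc (g(Suc n := y)) v (Suc n) \<longleftrightarrow> y \<in> subtree g n v"
    using assms by (auto simp: desc_iff desc_fun_upd subtree_def)
  have "subtree (g(Suc n := y)) (Suc n) v
    = (if y \<in> subtree g n v then insert (Suc n) (subtree g n v) else subtree g n v)" 
    unfolding new[symmetric] by (auto simp: subtree_def desc_fun_upd le_Suc_eq)
  moreover have "Suc n \<notin> subtree g n v" by (simp add: subtree_def)
  ultimately show ?thesis by simp
qed

text \<open>One urn step: the new vertex joins the subtree of \<open>v\<close> exactly when its
  parent lies in it, hence for as many choices of \<open>y\<close> as the subtree has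
  vertices.\<close>

lemma sum_subtree_extend:
  fixes h :: "nat \<Rightarrow> real"
  assumes "v \<le> n" and "n \<ge> 1"
  shows "(\<Sum>y\<in>{1..n}. h (card (subtree (g(Suc n := y)) (Suc n) v)))
    = card (subtree g n v) * h (card (subtree g n v) + 1)
      + (real n - card (subtree g n v)) * h (card (subtree g n v))"
proof -
  let ?T = "subtree g n v" and ?c = "card (subtree g n v)"
  have sub: "?T \<subseteq> {1..n}" by (auto simp: subtree_def)
  have "(\<Sum>y\<in>{1..n}. h (card (subtree (g(Suc n := y)) (Suc n) v)))
      = (\<Sum>y\<in>{1..n}. if y \<in> ?T then h (?c + 1) else h ?c)"
  proof (rule sum.cong)
    fix y assume "y \<in> {1..n}"
    then show "h (card (subtree (g(Suc n := y)) (Suc n) v)) = (if y \<in> ?T then h (?c + 1) else h ?c)"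
      by (subst subtree_extend[OF assms(1)]) auto
  qed simp
  also have "\<dots> = ?c * h (?c + 1) + card ({1..n} - ?T) * h ?c"
    using sub by (simp add: sum.If_cases Int_absorb1 Diff_eq)
  also have "real (card ({1..n} - ?T)) = real n - ?c"
    using sub card_mono[OF _ sub] by (simp add: card_Diff_subset)
  finally show ?thesis .
qed

text \<open>The sizes of a subtree and of its complement evolve as a Polya urn.\<close>

lemma mean_subtree_size:
  assumes "1 \<le> v" "v \<le> n"
  shows "parent_mean n (\<lambda>f. card (subtree f n v)) = real n / v"
  using assms(2)
proof (induction n rule: dec_induct)
  case base
  then show ?case using assms by (simp add: subtree_fresh)
next
  case (step n)
  have n: "n \<ge> 1" using assms step by simp
  \<comment> \<open>With \<open>c\<close> the current size,
    \<open>c * (c + 1) + (n - c) * c = (n + 1) * c\<close>.\<close>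
  have "parent_mean (Suc n) (\<lambda>f. card (subtree f (Suc n) v))
      = parent_mean n (\<lambda>g. ((real n + 1) / n) * card (subtree g n v))"
    unfolding parent_mean_Suc[OF n] sum_subtree_extend[OF step(1) n, of real]
    using n by (intro parent_mean_cong) (simp add: field_simps)
  also have "\<dots> = real (Suc n) / v"
    unfolding parent_mean_cmult step.IH using n by simp
  finally show ?case .
qed

text \<open>One urn step multiplies the mean of \<open>c * (c + 1)\<close> by exactly
  \<open>(n + 2) / n\<close>, which closes the recursion; for the plain square a linear term would
  be left over.\<close>

lemma mean_subtree_size_square:
  assumes "1 \<le> v" "v \<le> n"
  shows "parent_mean n (\<lambda>f. real (card (subtree f n v)) * (card (subtree f n v) + 1))
    = 2 * real n * (n + 1) / (v * (v + 1))"
  using assms(2)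
proof (induction n rule: dec_induct)
  case base
  have "real v + real v * real v > 0" using assms by (intro add_pos_nonneg) auto
  then show ?case using assms by (simp add: subtree_fresh field_simps)
next
  case (step n)
  have n: "n \<ge> 1" using assms step by simp
  have "parent_mean (Suc n) (\<lambda>f. real (card (subtree f (Suc n) v)) * (card (subtree f (Suc n) v) + 1))
      = parent_mean n (\<lambda>g. ((real n + 2) / n) * (real (card (subtree g n v)) * (card (subtree g n v) + 1)))"
    unfolding parent_mean_Suc[OF n] sum_subtree_extend[OF step(1) n, of "\<lambda>c. real c * (c + 1)"]
    using n by (intro parent_mean_cong) (simp add: field_simps)
  also have "\<dots> = 2 * real (Suc n) * (Suc n + 1) / (v * (v + 1))"
  proof -
    have "((real n + 2) / n) * (2 * real n * (n + 1) / c) = 2 * real (Suc n) * (Suc n + 1) / c" for c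
      using n by (cases "c = 0") (simp_all add: field_simps)
    then show ?thesis unfolding parent_mean_cmult step.IH .
  qed
  finally show ?case .
qed

text \<open>The first moment would only give \<open>n / (v * m)\<close>; its sum over \<open>v\<close> exceeds \<open>n / m\<close> by a
  logarithmic factor.\<close>

lemma mean_large_subtree:
  assumes "1 \<le> v" "v \<le> n" "m > 0"
  shows "parent_mean n (\<lambda>f. of_bool (m \<le> card (subtree f n v)))
    \<le> (2 * real n * (n + 1) / (real m)\<^sup>2) * (1 / (real v * (v + 1)))"
proof -
  have "parent_mean n (\<lambda>f. of_bool (m \<le> card (subtree f n v)))
    \<le> parent_mean n (\<lambda>f. (1 / (real m)\<^sup>2) * (real (card (subtree f n v)) * (card (subtree f n v) + 1)))"
  proof (rule parent_mean_mono)
    fix f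
    have "(real m)\<^sup>2 \<le> real c * (c + 1)" if "m \<le> c" for c
      using that unfolding power2_eq_square by (intro mult_mono) auto
    then show "of_bool (m \<le> card (subtree f n v))
      \<le> (1 / (real m)\<^sup>2) * (real (card (subtree f n v)) * (card (subtree f n v) + 1))"
      using assms(3) by (auto simp: field_simps)
  qed
  also have "\<dots> = (2 * real n * (n + 1) / (real m)\<^sup>2) * (1 / (real v * (v + 1)))"
  proof -
    have "(1 / M) * (N / c) = (N / M) * (1 / c)" for M N c :: real by simp
    then show ?thesis
      unfolding parent_mean_cmult mean_subtree_size_square[OF assms(1,2)] of_nat_mult .
  qed
  finally show ?thesis .
qed

section \<open>Mean numbers of large subtrees and of descendant pairs\<close>

lemma sum_inverse_telescope:
  assumes "a \<le> b"
  shows "(\<Sum>v\<in>{Suc a..b}. 1 / (real v * (v + 1))) = 1 / (real a + 1) - 1 / (real b + 1)"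
  using assms
proof (induction b rule: dec_induct)
  case (step b)
  then have "{Suc a..Suc b} = insert (Suc b) {Suc a..b}" by auto
  moreover have "1 / (real (Suc b) * (Suc b + 1)) = 1 / (real b + 1) - 1 / (real (Suc b) + 1)"
    by (simp add: field_simps)
  ultimately show ?case using step by simp
qed simp

text \<open>The vertices up to \<open>a = n div m\<close> are counted trivially and contribute at
  most \<open>n / m\<close>. For the later ones the second-moment bounds telescope to at most
  \<open>2 * (n + 1) / m\<close>.\<close>

lemma mean_number_large_subtrees:
  assumes "m > 0" "n \<ge> 1"
  shows "parent_mean n (\<lambda>f. \<Sum>v\<in>{2..n}. of_bool (m \<le> card (subtree f n v))) \<le> 5 * real n / m"
proof -
  define a where "a = n div m"
  have a: "a \<le> n" "real a \<le> real n / m" "real n / m \<le> a + 1"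
  proof -
    show "a \<le> n" unfolding a_def by simp
    show "real a \<le> real n / m" unfolding a_def by (rule of_nat_div_le_of_nat)
    have "n \<le> (a + 1) * m"
      using dividend_less_div_times[OF assms(1), of n] unfolding a_def by (simp add: algebra_simps)
    then have "real n \<le> (real a + 1) * m" by (metis of_nat_1 of_nat_add of_nat_le_iff of_nat_mult)
    then show "real n / m \<le> a + 1" using assms by (simp add: field_simps)
  qed
  have "parent_mean n (\<lambda>f. \<Sum>v\<in>{2..n}. of_bool (m \<le> card (subtree f n v)))
      \<le> parent_mean n (\<lambda>f. real a + (\<Sum>v\<in>{Suc a..n}. of_bool (m \<le> card (subtree f n v))))"
  proof (rule parent_mean_mono)
    fix f
    let ?h = "\<lambda>v. of_bool (m \<le> card (subtree f n v)) :: real"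
    have "sum ?h {2..n} \<le> sum ?h ({1..a} \<union> {Suc a..n})" by (rule sum_mono2) auto
    also have "\<dots> = sum ?h {1..a} + sum ?h {Suc a..n}" by (rule sum.union_disjoint) auto
    also have "sum ?h {1..a} \<le> (\<Sum>v\<in>{1..a}. 1)" by (intro sum_mono) auto
    finally show "sum ?h {2..n} \<le> real a + sum ?h {Suc a..n}" by simp
  qed
  also have "\<dots> = real a + (\<Sum>v\<in>{Suc a..n}. parent_mean n (\<lambda>f. of_bool (m \<le> card (subtree f n v))))"
    by (simp only: parent_mean_add parent_mean_sum parent_mean_const)
  also have "\<dots> \<le> real a + (\<Sum>v\<in>{Suc a..n}. (2 * real n * (n + 1) / (real m)\<^sup>2) * (1 / (real v * (v + 1))))"
  proof (intro add_left_mono sum_mono)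
    fix v assume "v \<in> {Suc a..n}"
    then show "parent_mean n (\<lambda>f. of_bool (m \<le> card (subtree f n v)))
      \<le> (2 * real n * (n + 1) / (real m)\<^sup>2) * (1 / (real v * (v + 1)))"
      using assms by (intro mean_large_subtree) auto
  qed
  also have "\<dots> = real a + (2 * real n * (n + 1) / (real m)\<^sup>2) * (1 / (real a + 1) - 1 / (real n + 1))"
    unfolding sum_distrib_left[symmetric] sum_inverse_telescope[OF a(1)] by simp
  also have "\<dots> \<le> real n / m + (2 * real n * (n + 1) / (real m)\<^sup>2) * (m / n)"
  proof (intro add_mono mult_left_mono a)
    have "1 / (real a + 1) \<le> 1 / (real n / m)"
      using a(3) assms by (intro divide_left_mono) auto
    moreover have "0 \<le> 1 / (real n + 1)" by simp
    ultimately show "1 / (real a + 1) - 1 / (real n + 1) \<le> real m / n"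
      unfolding divide_divide_eq_right mult_1 by linarith
  qed auto
  also have "\<dots> = (real n + 2 * (real n + 1)) / m"
    using assms by (simp add: field_simps power2_eq_square)
  \<comment> \<open>The numerator is \<open>3 * n + 2\<close>, which is at most \<open>5 * n\<close>
    as \<open>n \<ge> 1\<close>.\<close>
  also have "\<dots> \<le> 5 * real n / m"
    using assms by (intro divide_right_mono) auto
  finally show ?thesis .
qed

lemma sum_inverse_le_ln:
  assumes "n \<ge> 1"
  shows "(\<Sum>v\<in>{2..n}. 1 / real v) \<le> ln n"
  using assms
proof (induction n rule: dec_induct)
  case (step n)
  then have "{2..Suc n} = insert (Suc n) {2..n}" by auto
  moreover have "1 / real (Suc n) \<le> ln (real (Suc n)) - ln (real n)"
  proof -
    have "ln (real n / real (Suc n)) \<le> real n / real (Suc n) - 1"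
      using step by (intro ln_le_minus_one) auto
    then show ?thesis using step by (simp add: ln_div field_simps)
  qed
  ultimately show ?case using step by simp
qed simp

text \<open>Counted by their upper vertex \<open>u\<close>, the pairs number at most the sum of the
  subtree sizes, and the subtree of \<open>u\<close> has mean size \<open>n / u\<close>. As
  \<open>u\<close> starts at 2, the harmonic sum is at most \<open>ln n\<close>.\<close>

lemma mean_number_descendant_pairs:
  assumes "n \<ge> 1"
  shows "parent_mean n (\<lambda>f. \<Sum>u\<in>{2..n}. \<Sum>v\<in>{2..n} - {u}. of_bool (desc f u v)) \<le> n * ln n"
proof -
  have "parent_mean n (\<lambda>f. \<Sum>u\<in>{2..n}. \<Sum>v\<in>{2..n} - {u}. of_bool (desc f u v))
      \<le> parent_mean n (\<lambda>f. \<Sum>u\<in>{2..n}. real (card (subtree f n u)))"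
  proof (intro parent_mean_mono sum_mono)
    fix f u
    have "{v \<in> {2..n} - {u}. desc f u v} \<subseteq> subtree f n u" by (auto simp: subtree_def)
    then have "card {v \<in> {2..n} - {u}. desc f u v} \<le> card (subtree f n u)"
      by (intro card_mono) auto
    then show "(\<Sum>v\<in>{2..n} - {u}. of_bool (desc f u v)) \<le> real (card (subtree f n u))"
      by (simp add: sum.If_cases of_bool_def Int_def)
  qed
  also have "\<dots> = (\<Sum>u\<in>{2..n}. real n / u)"
    unfolding parent_mean_sum by (intro sum.cong) (auto simp: mean_subtree_size)
  also have "\<dots> = n * (\<Sum>u\<in>{2..n}. 1 / real u)" by (simp add: sum_distrib_left)
  also have "\<dots> \<le> n * ln n" by (intro mult_left_mono sum_inverse_le_ln assms) auto
  finally show ?thesis .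
qed

section \<open>Entries of random permutations\<close>

text \<open>Renaming the entries by a permutation of \<open>S\<close> that sends \<open>a\<close> to
  \<open>a'\<close> and \<open>b\<close> to \<open>b'\<close> injects the first set into the second;
  exchanging the roles gives equality.\<close>

lemma card_permutations_pair_le:
  assumes "a \<in> S" "b \<in> S" "a \<noteq> b" "a' \<in> S" "b' \<in> S" "a' \<noteq> b'" "i < card S" "j < card S"
  shows "card {xs \<in> permutations_of_set S. xs ! i = a \<and> xs ! j = b}
    \<le> card {xs \<in> permutations_of_set S. xs ! i = a' \<and> xs ! j = b'}"
proof -
  \<comment> \<open>The first transposition moves \<open>b\<close> to \<open>c\<close>, which the
    second one moves to \<open>b'\<close>; the second leaves \<open>a'\<close> alone since neither
    \<open>c\<close> nor \<open>b'\<close> equals \<open>a'\<close>.\<close>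
  define c where "c = Transposition.transpose a a' b"
  define \<sigma> where "\<sigma> = Transposition.transpose c b' \<circ> Transposition.transpose a a'"
  have c: "c \<in> S" "c \<noteq> a'" using assms by (auto simp: c_def Transposition.transpose_def)
  have perm: "\<sigma> permutes S"
    unfolding \<sigma>_def using assms c by (intro permutes_compose permutes_swap_id)
  have \<sigma>: "\<sigma> a = a'" "\<sigma> b = b'"
    using assms c by (simp_all add: \<sigma>_def c_def[symmetric] transpose_apply_other)
  show ?thesis
  proof (rule card_inj_on_le)
    show "inj_on (map \<sigma>) {xs \<in> permutations_of_set S. xs ! i = a \<and> xs ! j = b}"
      using permutes_inj[OF perm] by (simp add: inj_on_def)
    show "map \<sigma> ` {xs \<in> permutations_of_set S. xs ! i = a \<and> xs ! j = b}
      \<subseteq> {xs \<in> permutations_of_set S. xs ! i = a' \<and> xs ! j = b'}"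
      using \<sigma> permutations_of_set_image_permutes[OF perm] assms(7,8)
      by (auto simp: length_finite_permutations_of_set)
  qed auto
qed

text \<open>Each ordered pair of distinct elements stands at the positions \<open>i\<close> and
  \<open>j\<close> in the same number \<open>k\<close> of permutations, so the two entries are
  uniform on such pairs.\<close>

lemma sum_permutations_pair:
  fixes h :: "'a \<Rightarrow> 'a \<Rightarrow> real"
  assumes S: "finite S" and ij: "i < card S" "j < card S" "i \<noteq> j"
  shows "(\<Sum>xs\<in>permutations_of_set S. h (xs ! i) (xs ! j)) / card (permutations_of_set S)
    = (\<Sum>a\<in>S. \<Sum>b\<in>S - {a}. h a b) / (real (card S) * (real (card S) - 1))"
proof -
  let ?P = "permutations_of_set S"
  define c where "c a b = card {xs \<in> ?P. xs ! i = a \<and> xs ! j = b}" for a b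
  have const: "c a b = c a' b'"
    if "a \<in> S" "b \<in> S - {a}" "a' \<in> S" "b' \<in> S - {a'}" for a b a' b'
    unfolding c_def using that ij by (intro antisym card_permutations_pair_le) auto
  obtain k where k: "\<And>a b. a \<in> S \<Longrightarrow> b \<in> S - {a} \<Longrightarrow> c a b = k"
  proof (cases "\<exists>a b. a \<in> S \<and> b \<in> S - {a}")
    case True
    then obtain a b where "a \<in> S" "b \<in> S - {a}" by blast
    then show ?thesis using that[of "c a b"] const[of _ _ a b] by blast
  next
    case False
    then show ?thesis using that by blast
  qed
  have key: "(\<Sum>xs\<in>?P. h (xs ! i) (xs ! j)) = real k * (\<Sum>a\<in>S. \<Sum>b\<in>S - {a}. h a b)"
    for h :: "'a \<Rightarrow> 'a \<Rightarrow> real"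
  proof -
    have "(\<Sum>xs\<in>?P. h (xs ! i) (xs ! j))
      = (\<Sum>xs\<in>?P. \<Sum>(a, b)\<in>Sigma S (\<lambda>a. S - {a}). if xs ! i = a \<and> xs ! j = b then h a b else 0)"
    proof (rule sum.cong)
      fix xs assume xs: "xs \<in> ?P"
      then have "length xs = card S" "set xs = S" "distinct xs"
        by (auto simp: permutations_of_set_def distinct_card)
      then have "(xs ! i, xs ! j) \<in> Sigma S (\<lambda>a. S - {a})"
        using ij nth_mem[of _ xs] by (auto simp: nth_eq_iff_index_eq)
      moreover have "(\<lambda>(a, b). if xs ! i = a \<and> xs ! j = b then h a b else 0)
        = (\<lambda>z. if (xs ! i, xs ! j) = z then case z of (a, b) \<Rightarrow> h a b else 0)"
        by auto
      ultimately show "h (xs ! i) (xs ! j)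
        = (\<Sum>(a, b)\<in>Sigma S (\<lambda>a. S - {a}). if xs ! i = a \<and> xs ! j = b then h a b else 0)"
        using S by simp
    qed simp
    also have "\<dots> = (\<Sum>(a, b)\<in>Sigma S (\<lambda>a. S - {a}). \<Sum>xs\<in>?P. if xs ! i = a \<and> xs ! j = b then h a b else 0)"
      by (subst sum.swap) (simp add: case_prod_unfold)
    also have "\<dots> = (\<Sum>(a, b)\<in>Sigma S (\<lambda>a. S - {a}). real k * h a b)"
    proof (rule sum.cong)
      fix z assume "z \<in> Sigma S (\<lambda>a. S - {a})"
      then obtain a b where ab: "z = (a, b)" "a \<in> S" "b \<in> S - {a}" by blast
      have "(\<Sum>xs\<in>?P. if xs ! i = a \<and> xs ! j = b then h a b else 0) = real (c a b) * h a b"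
        by (simp add: c_def sum.If_cases Int_def)
      then show "(case z of (a, b) \<Rightarrow> \<Sum>xs\<in>?P. if xs ! i = a \<and> xs ! j = b then h a b else 0)
        = (case z of (a, b) \<Rightarrow> real k * h a b)"
        using k[of a b] ab by simp
    qed simp
    also have "\<dots> = real k * (\<Sum>a\<in>S. \<Sum>b\<in>S - {a}. h a b)"
      using S by (simp add: sum.Sigma[symmetric] sum_distrib_left)
    finally show ?thesis .
  qed
  have "card S \<ge> 2" using ij by linarith
  \<comment> \<open>The constant function 1 determines \<open>k\<close> implicitly, without counting
    permutations.\<close>
  have "real (card ?P) = real k * (\<Sum>a\<in>S. \<Sum>b\<in>S - {a}. 1)"
    using key[of "\<lambda>_ _. 1"] by simp
  also have "(\<Sum>a\<in>S. \<Sum>b\<in>S - {a}. 1) = real (card S) * (real (card S) - 1)"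
    using S \<open>card S \<ge> 2\<close> by (simp add: card_Diff_singleton_if of_nat_diff)
  finally have P: "real (card ?P) = real k * (real (card S) * (real (card S) - 1))" .
  moreover have "real (card ?P) \<noteq> 0" using S by simp
  ultimately have "k \<noteq> 0" by auto
  then show ?thesis unfolding key[of h] P by simp
qed

text \<open>Apply the formula for pairs to a summand that ignores its second argument; a second
  position \<open>j\<close> exists because \<open>card S \<ge> 2\<close>.\<close>

lemma sum_permutations_nth:
  fixes g :: "'a \<Rightarrow> real"
  assumes S: "finite S" and i: "i < card S" and two: "card S \<ge> 2"
  shows "(\<Sum>xs\<in>permutations_of_set S. g (xs ! i)) / card (permutations_of_set S) = (\<Sum>a\<in>S. g a) / card S"
proof -
  obtain j where j: "j < card S" "i \<noteq> j"
    using two that[of "if i = 0 then 1 else 0"] by (auto split: if_splits)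
  have "(\<Sum>xs\<in>permutations_of_set S. g (xs ! i)) / card (permutations_of_set S)
    = (\<Sum>a\<in>S. \<Sum>b\<in>S - {a}. g a) / (real (card S) * (real (card S) - 1))"
    using sum_permutations_pair[OF S i j, of "\<lambda>a b. g a"] .
  also have "(\<Sum>a\<in>S. \<Sum>b\<in>S - {a}. g a) = (real (card S) - 1) * (\<Sum>a\<in>S. g a)"
    using S two unfolding sum_distrib_left by (intro sum.cong) (auto simp: card_Diff_singleton_if of_nat_diff)
  finally show ?thesis using two by simp
qed

section \<open>The root cluster\<close>

text \<open>The edges, named by their lower ends, that are still connected to the root when the edges
  of \<open>D\<close> have been considered.\<close>

definition root_cluster :: "(nat \<Rightarrow> nat) \<Rightarrow> nat \<Rightarrow> nat set \<Rightarrow> nat set" where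
  "root_cluster f n D = {v \<in> {2..n}. \<forall>u\<in>D. \<not> desc f u v}"

lemma root_cluster_insert_subset: "root_cluster f n (insert v D) \<subseteq> root_cluster f n D - {v}"
  by (auto simp: root_cluster_def desc.refl)

text \<open>An edge outside the cluster already has an edge of \<open>D\<close> at or above it, and
  by transitivity that edge is above everything below \<open>v\<close>.\<close>

lemma root_cluster_insert_eq:
  assumes "v \<in> {2..n}" "v \<notin> root_cluster f n D"
  shows "root_cluster f n (insert v D) = root_cluster f n D"
  using assms by (auto simp: root_cluster_def intro: desc_trans)

text \<open>Ancestors of \<open>f v\<close> are ancestors of \<open>v\<close>, so climbing towards
  the root never leaves the cluster.\<close>

lemma root_cluster_parent:
  assumes "f \<in> parent_maps n" "v \<in> root_cluster f n D" "f v \<noteq> 1"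
  shows "f v \<in> root_cluster f n D"
proof -
  have v: "v \<in> {2..n}" using assms by (auto simp: root_cluster_def)
  from parent_in[OF assms(1) v] show ?thesis
    using assms v by (auto simp: root_cluster_def intro: desc.step)
qed

lemma root_cluster_top:
  assumes f: "f \<in> parent_maps n" and "v \<in> root_cluster f n D"
  obtains w where "w \<in> root_cluster f n D" "f w = 1"
  using assms(2)
proof (induction v arbitrary: thesis rule: less_induct)
  case (less v)
  then have v: "v \<in> {2..n}" by (auto simp: root_cluster_def)
  show ?case
  proof (cases "f v = 1")
    case True
    then show ?thesis using less.prems by blast
  next
    case False
    then show ?thesis
      using less.IH[of "f v"] less.prems root_cluster_parent[OF f less.prems(2)] parent_in[OF f v] by auto
  qed
qed

text \<open>An unconsidered edge outside the cluster has an edge \<open>u\<close> of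
  \<open>D\<close> strictly above it, so both its ends are \<open>u\<close> or descend from
  \<open>u\<close>. An edge sharing one of these ends then has \<open>u\<close> at or above it and
  is not in the cluster.\<close>

lemma root_cluster_adjacent:
  assumes f: "f \<in> parent_maps n" and v: "v \<in> root_cluster f n D" and w: "w \<in> {2..n} - D"
    and adj: "edge f v \<inter> edge f w \<noteq> {}"
  shows "w \<in> root_cluster f n D"
proof (rule ccontr)
  assume "w \<notin> root_cluster f n D"
  then obtain u where u: "u \<in> D" "desc f u w" using w by (auto simp: root_cluster_def)
  then have "u < w" using w desc_le[OF u(2)] by (cases "u = w") auto
  then have "desc f u (f w)" using u by (simp add: desc_iff)
  moreover have "f v < v" using v parent_in[OF f, of v] by (auto simp: root_cluster_def)
  ultimately have "desc f u v" using adj u by (auto simp: edge_def intro: desc.step)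
  with u v show False by (auto simp: root_cluster_def)
qed

text \<open>Unconsidered edges outside the cluster never touch it, so a fire started at one of them
  cannot jump into the cluster.\<close>

lemma fire_spread_avoids_root_cluster:
  assumes f: "f \<in> parent_maps n" and A: "A \<subseteq> edge f ` ({2..n} - D)"
    and w: "w \<in> {2..n} - D - root_cluster f n D"
  shows "fire_spread A (edge f w) \<subseteq> edge f ` ({2..n} - D - root_cluster f n D)"
proof
  fix g assume "g \<in> fire_spread A (edge f w)"
  then show "g \<in> edge f ` ({2..n} - D - root_cluster f n D)"
  proof induction
    case start
    then show ?case using w by blast
  next
    case (spread e g)
    from spread(4) obtain u where u: "e = edge f u" "u \<in> {2..n} - D - root_cluster f n D" by blast
    from spread A obtain v where v: "g = edge f v" "v \<in> {2..n} - D" by blast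
    have "v \<notin> root_cluster f n D"
      using root_cluster_adjacent[OF f, of v D u] u v spread(3) by (auto simp: Int_commute)
    then show ?case using v by blast
  qed
qed

text \<open>The fire climbs from \<open>w\<close> to an edge at the root, spreads there to all
  cluster edges at the root, and descends from them through the rest of the cluster.\<close>

lemma fire_spread_root_cluster:
  assumes f: "f \<in> parent_maps n" and A: "edge f ` root_cluster f n D \<subseteq> A"
    and w: "w \<in> root_cluster f n D"
  shows "edge f ` root_cluster f n D \<subseteq> fire_spread A (edge f w)"
proof -
  let ?R = "root_cluster f n D" and ?B = "fire_spread A (edge f w)"
  have lt: "f v < v" if "v \<in> ?R" for v
    using parent_in[OF f, of v] that by (auto simp: root_cluster_def)
  have up: "\<exists>v1\<in>?R. f v1 = 1 \<and> edge f v1 \<in> ?B" if "v \<in> ?R" "edge f v \<in> ?B" for v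
    using that
  proof (induction v rule: less_induct)
    case (less v)
    show ?case
    proof (cases "f v = 1")
      case False
      then have R: "f v \<in> ?R" using root_cluster_parent[OF f] less.prems by blast
      then have "edge f (f v) \<in> A" using A by blast
      with less.prems(2) have "edge f (f v) \<in> ?B"
        by (rule fire_spread.spread) (auto simp: edge_def)
      then show ?thesis using less.IH[of "f v"] lt less.prems R by blast
    qed (use less.prems in blast)
  qed
  obtain v1 where v1: "v1 \<in> ?R" "f v1 = 1" "edge f v1 \<in> ?B"
    using up[OF w fire_spread.start] by blast
  have "edge f v \<in> ?B" if "v \<in> ?R" for v
    using that
  proof (induction v rule: less_induct)
    case (less v)
    show ?case
    proof (cases "f v = 1")
      case True
      have "edge f v \<in> A" using A less.prems by blast
      with v1(3) show ?thesis
        by (rule fire_spread.spread) (use True v1 in \<open>auto simp: edge_def\<close>)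
    next
      case False
      then have R: "f v \<in> ?R" using root_cluster_parent[OF f] less.prems by blast
      then have "edge f (f v) \<in> ?B" using less.IH[of "f v"] lt less.prems by blast
      moreover have "edge f v \<in> A" using A less.prems by blast
      ultimately show ?thesis
        by (rule fire_spread.spread) (auto simp: edge_def)
    qed
  qed
  then show ?thesis by blast
qed

section \<open>Fireproof subtrees after the root cluster has burnt\<close>

lemma fire_dynamics_subset:
  "F' \<in> set_pmf (fire_dynamics p es A F) \<Longrightarrow> F' \<subseteq> F \<union> A"
  by (induction es arbitrary: A F) (fastforce split: if_splits)+

text \<open>A fireproof subtree avoids the burnt root cluster. Climbing from it towards the root, one
  therefore meets an edge of \<open>D\<close>; below the topmost such edge the subtree is confined.\<close>

lemma largest_fireproof_size_less:
  assumes f: "f \<in> parent_maps n" and D: "D \<subseteq> {2..n}" and R: "root_cluster f n D \<noteq> {}"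
    and F: "F \<inter> edge f ` root_cluster f n D = {}"
    and small: "\<And>d. d \<in> D \<Longrightarrow> card (subtree f n d) < m" and m: "m > 0"
  shows "largest_fireproof_size {1..n} (edge f ` {2..n}) F < m"
proof -
  let ?E = "edge f ` {2..n}" and ?V = "{1..n}" and ?R = "root_cluster f n D"
  let ?W = "fireproof_vertices ?V ?E F" and ?G = "final_forest ?V ?E F"
  have "card C < m" if "C \<in> fireproof_subtrees ?V ?E F" for C
  proof -
    from that obtain u where u: "u \<in> ?V" and C: "C = {v \<in> ?V. (u, v) \<in> linked ?G}" and CW: "C \<subseteq> ?W"
      by (auto simp: fireproof_subtrees_def graph_components_def)
    have incident: "e \<in> F" if "v \<in> ?W" "e \<in> ?E" "v \<in> e" for v e
      using that by (auto simp: fireproof_vertices_def)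
    have *: "edge f w \<in> ?E" "edge f w \<notin> F" if "w \<in> ?R" for w
      using that F by (auto simp: root_cluster_def)
    have notR: "v \<notin> ?R" "\<forall>w\<in>?R. f w \<noteq> v" if "v \<in> ?W" for v
    proof -
      have "v \<notin> edge f w" if "w \<in> ?R" for w
        using *[OF that] incident[OF \<open>v \<in> ?W\<close>] by blast
      then show "v \<notin> ?R" "\<forall>w\<in>?R. f w \<noteq> v" by (auto simp: edge_def)
    qed
    \<comment> \<open>The cluster contains an edge at the root. It is not in \<open>F\<close>, so
      the root is not fireproof.\<close>
    from R obtain t where t: "t \<in> ?R" "f t = 1" using root_cluster_top[OF f] by blast
    have uW: "u \<in> ?W" using u C CW by (auto simp: linked_def)
    have "u \<noteq> 1" using notR(2)[OF uW] t by auto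
    with u have "u \<in> {2..n}" by auto
    with notR(1)[OF uW] obtain d' where "d' \<in> D" "desc f d' u" by (auto simp: root_cluster_def)
    \<comment> \<open>The least \<open>d\<close> is the topmost edge of \<open>D\<close> above
      \<open>u\<close>, since ancestors have smaller numbers.\<close>
    then obtain d where d: "d \<in> D" "desc f d u" and least: "\<And>d'. d' \<in> D \<Longrightarrow> desc f d' u \<Longrightarrow> d \<le> d'"
      using LeastI[of "\<lambda>d. d \<in> D \<and> desc f d u" d'] Least_le[of "\<lambda>d. d \<in> D \<and> desc f d u"] by blast
    have dn: "d \<in> {2..n}" using d D by blast
    have fd: "f d \<in> {1..<d}" by (rule parent_in[OF f dn])
    \<comment> \<open>A fireproof \<open>f d\<close> would, like \<open>u\<close>, have an edge of
      \<open>D\<close> at or above it; that edge would lie strictly above \<open>d\<close>, against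
      the choice of \<open>d\<close>.\<close>
    have top: "f d \<notin> ?W"
    proof
      assume W: "f d \<in> ?W"
      then have "f d \<noteq> 1" using notR(2)[OF W] t by auto
      then have "f d \<in> {2..n}" using fd dn by auto
      with notR(1)[OF W] obtain d' where d': "d' \<in> D" "desc f d' (f d)" by (auto simp: root_cluster_def)
      from desc.step[OF this(2)] fd have "desc f d' d" by simp
      then have "desc f d' u" using d(2) by (rule desc_trans)
      then have "d \<le> d'" using least[OF d'(1)] by blast
      then show False using desc_le[OF d'(2)] fd by auto
    qed
    have "desc f d v" if "(u, v) \<in> linked ?G" for v
      using that unfolding linked_def
    proof (induction rule: rtrancl_induct)
      case base
      show ?case by (rule d(2))
    next
      case (step x y)
      then have xyG: "{x, y} \<in> ?G" by auto
      then have xyE: "{x, y} \<in> ?E" by (auto simp: final_forest_def)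
      then obtain k where k: "k \<in> {2..n}" "{x, y} = edge f k" by blast
      with parent_in[OF f k(1)] have "x \<in> ?V" by (auto simp: edge_def doubleton_eq_iff)
      \<comment> \<open>An edge at a fireproof vertex is in \<open>F\<close>; as it has not been
        discarded, its other end is fireproof as well. Hence the walk never reaches
        \<open>f d\<close>, the only way out of the subtree of \<open>d\<close>.\<close>
      then have "x \<in> ?W" using step(1) C CW by (auto simp: linked_def)
      then have "{x, y} \<in> F" using incident xyE by blast
      with xyG have "y \<in> ?W" by (auto simp: final_forest_def)
      then have "y \<noteq> f d" using top by blast
      consider "x = k" "y = f k" | "x = f k" "y = k"
        using k(2) by (auto simp: edge_def doubleton_eq_iff)
      then show ?case
      proof cases
        case 1
        then have "d \<noteq> x" using \<open>y \<noteq> f d\<close> by auto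
        then have "d < x" using desc_le[OF step.IH] by auto
        then show ?thesis using step.IH 1 desc_iff by auto
      next
        case 2
        then show ?thesis using step.IH parent_in[OF f k(1)] by (auto intro: desc.step)
      qed
    qed
    then have "C \<subseteq> subtree f n d" using C by (auto simp: subtree_def)
    then have "card C \<le> card (subtree f n d)" by (intro card_mono) (auto simp: subtree_def)
    then show ?thesis using small[OF d(1)] by simp
  qed
  moreover have "finite (fireproof_subtrees ?V ?E F)"
    by (rule finite_subset[of _ "Pow ?V"]) (auto simp: fireproof_subtrees_def graph_components_def)
  ultimately show ?thesis using m by (simp add: largest_fireproof_size_def)
qed

text \<open>The number of chances to set the unburnt root cluster on fire. For a given tree it
  depends on the order alone, because the cluster is determined by the edges considered so far and
  not by the random outcomes.\<close>

definition fresh_count :: "(nat \<Rightarrow> nat) \<Rightarrow> nat \<Rightarrow> nat set \<Rightarrow> nat list \<Rightarrow> nat" where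
  "fresh_count f n D vs = (\<Sum>j<length vs. of_bool (vs ! j \<in> root_cluster f n (D \<union> set (take j vs))))"

lemma fresh_count_Nil [simp]: "fresh_count f n D [] = 0"
  by (simp add: fresh_count_def)

lemma fresh_count_Cons [simp]:
  "fresh_count f n D (v # vs) = of_bool (v \<in> root_cluster f n D) + fresh_count f n (insert v D) vs"
  by (simp add: fresh_count_def sum.lessThan_Suc_shift del: sum.lessThan_Suc)

section \<open>Survival probability of the root cluster\<close>

lemma measure_bind_pmf_expectation:
  "measure_pmf.prob (bind_pmf M g) X = measure_pmf.expectation M (\<lambda>x. measure_pmf.prob (g x) X)"
  unfolding measure_pmf_bind
  by (rule measure_pmf.measure_bind[where N = "count_space UNIV"]) (auto simp: measure_subprob)

lemma measure_bind_bernoulli_pmf: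
  assumes "0 \<le> p" "p \<le> 1"
  shows "measure_pmf.prob (bind_pmf (bernoulli_pmf p) g) X
    = p * measure_pmf.prob (g True) X + (1 - p) * measure_pmf.prob (g False) X"
  using assms by (simp add: measure_bind_pmf_expectation)

text \<open>An edge that is still in the root cluster when its turn comes is set on fire with
  probability \<open>p\<close>, and then the whole cluster burns, so that the preceding lemma applies.\<close>

lemma fire_dynamics_largest:
  assumes f: "f \<in> parent_maps n" and p: "0 \<le> p" "p \<le> 1" and m: "m > 0"
    and "D \<subseteq> {2..n}" "set vs \<subseteq> {2..n}" "edge f ` root_cluster f n D \<subseteq> A"
    "A \<subseteq> edge f ` ({2..n} - D)" "F \<subseteq> edge f ` D"
    and "\<And>d. d \<in> D \<union> set vs \<Longrightarrow> card (subtree f n d) < m"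
  shows "measure_pmf.prob (fire_dynamics p (map (edge f) (vs @ ws)) A F)
    {F'. m \<le> largest_fireproof_size {1..n} (edge f ` {2..n}) F'} \<le> (1 - p) ^ fresh_count f n D vs"
  using assms(5-)
\<comment> \<open>The hypotheses form an invariant: the cluster is still flammable, no edge of
  \<open>D\<close> is flammable any more, and the fireproof edges come from
  \<open>D\<close>.\<close>
proof (induction vs arbitrary: D A F)
  case Nil
  then show ?case by simp
next
  case (Cons v vs)
  let ?R = "root_cluster f n" and ?Z = "{F'. m \<le> largest_fireproof_size {1..n} (edge f ` {2..n}) F'}"
  let ?D = "insert v D" and ?B = "fire_spread A (edge f v)"
  define q where "q A F = measure_pmf.prob (fire_dynamics p (map (edge f) (vs @ ws)) A F) ?Z" for A F
  have v: "v \<in> {2..n}" using Cons.prems by auto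
  have inj: "x = y" if "edge f x = edge f y" "x \<in> {2..n}" "y \<in> {2..n}" for x y
    using inj_onD[OF inj_on_edge[OF f] that] .
  have IH: "q A' F' \<le> (1 - p) ^ fresh_count f n ?D vs"
    if "edge f ` ?R ?D \<subseteq> A'" "A' \<subseteq> edge f ` ({2..n} - D)" "edge f v \<notin> A'" "F' \<subseteq> edge f ` ?D" for A' F'
    unfolding q_def
  proof (rule Cons.IH)
    show "A' \<subseteq> edge f ` ({2..n} - ?D)" using that(2,3) by blast
  qed (use that Cons.prems in auto)
  have shrink: "?R ?D \<subseteq> ?R D - {v}" by (rule root_cluster_insert_subset)
  then have "edge f ` ?R ?D \<subseteq> edge f ` ?R D" by (intro image_mono) blast
  with Cons.prems(3) have RA: "edge f ` ?R ?D \<subseteq> A" by (rule order_trans[rotated])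
  have FD: "F \<subseteq> edge f ` ?D" using Cons.prems(5) by (rule order_trans) blast
  show ?case
  proof (cases "edge f v \<in> A")
    case False
    then have vR: "v \<notin> ?R D" using Cons.prems(3) by blast
    have "q A F \<le> (1 - p) ^ fresh_count f n ?D vs"
      by (rule IH[OF RA Cons.prems(4) False FD])
    then show ?thesis using False vR by (simp add: q_def)
  next
    case True
    with Cons.prems(4) obtain w where "w \<in> {2..n} - D" "edge f v = edge f w" by blast
    then have vD: "v \<notin> D" using inj v by auto
    have split: "measure_pmf.prob (fire_dynamics p (map (edge f) ((v # vs) @ ws)) A F) ?Z
      = p * q (A - ?B) F + (1 - p) * q (A - {edge f v}) (insert (edge f v) F)"
      using True p by (simp add: q_def measure_bind_bernoulli_pmf)
    have "edge f x \<noteq> edge f v" if "x \<in> ?R ?D" for x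
      using inj[of x v] that v shrink by (auto simp: root_cluster_def)
    then have "edge f ` ?R ?D \<subseteq> A - {edge f v}" using RA by blast
    then have proof_case: "q (A - {edge f v}) (insert (edge f v) F) \<le> (1 - p) ^ fresh_count f n ?D vs"
    proof (rule IH)
      show "A - {edge f v} \<subseteq> edge f ` ({2..n} - D)" using Cons.prems(4) by (rule order_trans[rotated]) blast
    qed (use FD in auto)
    show ?thesis
    proof (cases "v \<in> ?R D")
      case True
      \<comment> \<open>Setting \<open>v\<close> on fire burns the whole cluster, so in every
        outcome the fireproof subtrees lie below edges of \<open>D\<close> and have fewer than
        \<open>m\<close> vertices.\<close>
      have "F' \<notin> ?Z" if "F' \<in> set_pmf (fire_dynamics p (map (edge f) (vs @ ws)) (A - ?B) F)" for F'
      proof -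
        have "F' \<subseteq> F \<union> (A - ?B)" using that by (rule fire_dynamics_subset)
        moreover have "edge f ` ?R D \<subseteq> ?B"
          by (rule fire_spread_root_cluster[OF f Cons.prems(3) True])
        moreover have "F \<inter> edge f ` ?R D = {}"
        proof -
          have D: "x \<notin> ?R D" if "x \<in> D" for x
            using that desc.refl unfolding root_cluster_def by blast
          have "edge f x \<noteq> edge f y" if "x \<in> D" "y \<in> ?R D" for x y
          proof
            assume "edge f x = edge f y"
            then have "x = y" using inj[of x y] that Cons.prems(1) unfolding root_cluster_def by blast
            with D that show False by blast
          qed
          then show ?thesis using Cons.prems(5) by blast
        qed
        ultimately have "F' \<inter> edge f ` ?R D = {}" by blast
        then have "largest_fireproof_size {1..n} (edge f ` {2..n}) F' < m"
          using Cons.prems True by (intro largest_fireproof_size_less[OF f _ _ _ _ m]) auto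
        then show ?thesis by simp
      qed
      then have "q (A - ?B) F = 0" unfolding q_def by (auto simp: measure_pmf_zero_iff)
      then show ?thesis unfolding split using True p proof_case by (simp add: mult_left_mono)
    next
      case False
      \<comment> \<open>Considering \<open>v\<close> leaves the cluster unchanged and a fire at
        \<open>v\<close> does not touch it, so the induction hypothesis covers both
        outcomes.\<close>
      have "?R ?D = ?R D" by (rule root_cluster_insert_eq[OF v False])
      have "?B \<subseteq> edge f ` ({2..n} - D - ?R D)"
        by (rule fire_spread_avoids_root_cluster[OF f Cons.prems(4)]) (use v vD False in blast)
      moreover have "edge f x \<noteq> edge f y" if "x \<in> {2..n} - D - ?R D" "y \<in> ?R D" for x y
        using inj[of x y] that by (auto simp: root_cluster_def)
      ultimately have "edge f ` ?R D \<inter> ?B = {}" by blast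
      with RA have "edge f ` ?R ?D \<subseteq> A - ?B" unfolding \<open>?R ?D = ?R D\<close> by blast
      then have "q (A - ?B) F \<le> (1 - p) ^ fresh_count f n ?D vs"
      proof (rule IH)
        show "A - ?B \<subseteq> edge f ` ({2..n} - D)" using Cons.prems(4) by (rule order_trans[rotated]) blast
      qed (use FD fire_spread.start in auto)
      then have "p * q (A - ?B) F + (1 - p) * q (A - {edge f v}) (insert (edge f v) F)
        \<le> p * (1 - p) ^ fresh_count f n ?D vs + (1 - p) * (1 - p) ^ fresh_count f n ?D vs"
        using p proof_case by (intro add_mono mult_left_mono) auto
      then show ?thesis unfolding split using False by (simp add: algebra_simps)
    qed
  qed
qed

text \<open>An entry that misses the cluster has an earlier entry above it, and so adds at least one
  to the double sum.\<close>

lemma length_le_fresh_count: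
  assumes "set vs \<subseteq> {2..n}"
  shows "length vs \<le> fresh_count f n {} vs + (\<Sum>j<length vs. \<Sum>i<j. of_bool (desc f (vs ! i) (vs ! j)))"
proof -
  have "length vs = (\<Sum>j<length vs. 1)" by simp
  also have "\<dots> \<le> (\<Sum>j<length vs. of_bool (vs ! j \<in> root_cluster f n (set (take j vs)))
      + (\<Sum>i<j. of_bool (desc f (vs ! i) (vs ! j))))"
  proof (rule sum_mono)
    fix j assume "j \<in> {..<length vs}"
    then have j: "j < length vs" by simp
    then have jn: "vs ! j \<in> {2..n}" using assms nth_mem by blast
    show "1 \<le> of_bool (vs ! j \<in> root_cluster f n (set (take j vs)))
      + (\<Sum>i<j. of_bool (desc f (vs ! i) (vs ! j)) :: nat)"
    proof (cases "vs ! j \<in> root_cluster f n (set (take j vs))")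
      case False
      with jn obtain u where "u \<in> set (take j vs)" "desc f u (vs ! j)" by (auto simp: root_cluster_def)
      with j obtain i where "i < j" "desc f (vs ! i) (vs ! j)" by (auto simp: in_set_conv_nth)
      then have "1 \<le> (\<Sum>i<j. of_bool (desc f (vs ! i) (vs ! j)) :: nat)"
        using member_le_sum[of i "{..<j}" "\<lambda>i. of_bool (desc f (vs ! i) (vs ! j)) :: nat"] by simp
      then show ?thesis by simp
    qed simp
  qed
  finally show ?thesis by (simp add: fresh_count_def sum.distrib)
qed

section \<open>Tightness\<close>

text \<open>The first term is at least 1 if one of the first \<open>M\<close> subtrees is large, and
  the last one if the double sum reaches \<open>M / 2\<close>. Otherwise more than
  \<open>M / 2\<close> of the first \<open>M\<close> edges are in the root cluster at their turn,
  and \<open>1 - p \<le> exp (- p)\<close> gives the middle term.\<close>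

lemma fire_dynamics_largest_order:
  fixes m n M :: nat and p :: real
  assumes f: "f \<in> parent_maps n" and p: "0 \<le> p" "p \<le> 1" and m: "m > 0"
    and vs: "vs \<in> permutations_of_set {2..n}" and M: "M > 0" "M \<le> n - 1"
  shows "measure_pmf.prob (fire_dynamics p (map (edge f) vs) (edge f ` {2..n}) {})
      {F. m \<le> largest_fireproof_size {1..n} (edge f ` {2..n}) F}
    \<le> (\<Sum>i<M. of_bool (m \<le> card (subtree f n (vs ! i)))) + exp (- p * M / 2)
      + 2 / M * (\<Sum>j<M. \<Sum>i<j. of_bool (desc f (vs ! i) (vs ! j)))"
    (is "?prob \<le> ?large + ?e + 2 / M * ?S")
proof -
  have len: "length (take M vs) = M" and set: "set (take M vs) \<subseteq> {2..n}"
    using M length_finite_permutations_of_set[OF vs] permutations_of_setD(1)[OF vs]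
    by (auto dest: in_set_takeD)
  have nonneg: "0 \<le> ?large" "0 \<le> ?e" "0 \<le> ?S" by (auto intro: sum_nonneg)
  show ?thesis
  proof (cases "\<exists>i<M. m \<le> card (subtree f n (vs ! i))")
    case True
    then obtain i where "i < M" "m \<le> card (subtree f n (vs ! i))" by blast
    then have "1 \<le> ?large"
      using member_le_sum[of i "{..<M}" "\<lambda>i. of_bool (m \<le> card (subtree f n (vs ! i))) :: real"] by simp
    moreover have "?prob \<le> 1" by simp
    moreover have "0 \<le> 2 / M * ?S" using nonneg by simp
    ultimately show ?thesis using nonneg by linarith
  next
    case False
    let ?N = "fresh_count f n {} (take M vs)"
    have "card (subtree f n d) < m" if "d \<in> {} \<union> set (take M vs)" for d
      using that False len by (auto simp: in_set_conv_nth not_le)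
    then have "measure_pmf.prob (fire_dynamics p (map (edge f) (take M vs @ drop M vs)) (edge f ` {2..n}) {})
      {F. m \<le> largest_fireproof_size {1..n} (edge f ` {2..n}) F} \<le> (1 - p) ^ ?N"
      by (intro fire_dynamics_largest f p m) (use set in \<open>auto simp: root_cluster_def\<close>)
    then have prob: "?prob \<le> (1 - p) ^ ?N" by simp
    have "(\<Sum>j<M. \<Sum>i<j. of_bool (desc f (take M vs ! i) (take M vs ! j)) :: nat)
      = (\<Sum>j<M. \<Sum>i<j. of_bool (desc f (vs ! i) (vs ! j)))"
      by (intro sum.cong) auto
    then have "M \<le> ?N + (\<Sum>j<M. \<Sum>i<j. of_bool (desc f (vs ! i) (vs ! j)))"
      using length_le_fresh_count[OF set, of f] len by simp
    then have "real M \<le> real (?N + (\<Sum>j<M. \<Sum>i<j. of_bool (desc f (vs ! i) (vs ! j))))"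
      by (rule of_nat_mono)
    then have N: "real M \<le> real ?N + ?S" by simp
    show ?thesis
    proof (cases "real M \<le> 2 * ?S")
      case True
      then have "1 \<le> 2 / M * ?S" using M by (simp add: field_simps)
      moreover have "?prob \<le> 1" by simp
      ultimately show ?thesis using nonneg by linarith
    next
      case False
      have "(1 - p) ^ ?N \<le> exp (- p) ^ ?N"
        using p exp_ge_add_one_self[of "- p"] by (intro power_mono) auto
      also have "\<dots> = exp (- p * ?N)" by (simp add: exp_of_nat_mult[symmetric] mult.commute)
      also have "\<dots> \<le> ?e"
      proof -
        have "p * (real M / 2) \<le> p * ?N" using N False p by (intro mult_left_mono) auto
        then show ?thesis by simp
      qed
      finally have "?prob \<le> ?e" using prob by simp
      moreover have "0 \<le> 2 / M * ?S" using nonneg by simp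
      ultimately show ?thesis using nonneg by linarith
    qed
  qed
qed

text \<open>In a uniform order each entry is uniform on the \<open>n - 1\<close> edges, and any two
  entries are uniform on ordered pairs of distinct edges. The factors 2 and 12 come from
  \<open>1 / (n - 1) \<le> 2 / n\<close> and
  \<open>1 / ((n - 1) * (n - 2)) \<le> 6 / n\<^sup>2\<close>, valid for
  \<open>n \<ge> 3\<close>.\<close>

lemma mean_fire_dynamics_largest:
  fixes m n M :: nat and p :: real
  assumes f: "f \<in> parent_maps n" and p: "0 \<le> p" "p \<le> 1" and m: "m > 0"
    and n: "n \<ge> 3" and M: "M > 0" "M \<le> n - 1"
  shows "(\<Sum>vs\<in>permutations_of_set {2..n}.
      measure_pmf.prob (fire_dynamics p (map (edge f) vs) (edge f ` {2..n}) {})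
        {F. m \<le> largest_fireproof_size {1..n} (edge f ` {2..n}) F}) / card (permutations_of_set {2..n})
    \<le> 2 * real M / n * (\<Sum>v\<in>{2..n}. of_bool (m \<le> card (subtree f n v))) + exp (- p * M / 2)
      + 12 * real M / (real n)\<^sup>2 * (\<Sum>u\<in>{2..n}. \<Sum>v\<in>{2..n} - {u}. of_bool (desc f u v))"
    (is "?lhs \<le> _ * ?X + _ + _ * ?Y")
proof -
  let ?P = "permutations_of_set {2..n}"
  let ?g = "\<lambda>v. of_bool (m \<le> card (subtree f n v)) :: real"
  let ?h = "\<lambda>u v. of_bool (desc f u v) :: real"
  have L: "real (card {2..n}) = real n - 1" "card {2..n} \<ge> 2" using n by auto
  have P: "real (card ?P) > 0" by simp
  have X0: "0 \<le> ?X" "0 \<le> ?Y" by (auto intro: sum_nonneg)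
  have "?lhs \<le> (\<Sum>vs\<in>?P. (\<Sum>i<M. ?g (vs ! i)) + exp (- p * M / 2)
      + 2 / M * (\<Sum>j<M. \<Sum>i<j. ?h (vs ! i) (vs ! j))) / card ?P"
    by (intro divide_right_mono sum_mono fire_dynamics_largest_order assms) auto
  also have "\<dots> = (\<Sum>i<M. (\<Sum>vs\<in>?P. ?g (vs ! i)) / card ?P) + exp (- p * M / 2)
      + 2 / M * (\<Sum>j<M. \<Sum>i<j. (\<Sum>vs\<in>?P. ?h (vs ! i) (vs ! j)) / card ?P)"
  proof -
    have "(\<Sum>vs\<in>?P. \<Sum>i<M. ?g (vs ! i)) = (\<Sum>i<M. \<Sum>vs\<in>?P. ?g (vs ! i))"
      by (rule sum.swap)
    moreover have "(\<Sum>vs\<in>?P. \<Sum>j<M. \<Sum>i<j. ?h (vs ! i) (vs ! j)) = (\<Sum>j<M. \<Sum>i<j. \<Sum>vs\<in>?P. ?h (vs ! i) (vs ! j))"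
    proof -
      have "(\<Sum>vs\<in>?P. \<Sum>j<M. \<Sum>i<j. ?h (vs ! i) (vs ! j)) = (\<Sum>j<M. \<Sum>vs\<in>?P. \<Sum>i<j. ?h (vs ! i) (vs ! j))"
        by (rule sum.swap)
      also have "\<dots> = (\<Sum>j<M. \<Sum>i<j. \<Sum>vs\<in>?P. ?h (vs ! i) (vs ! j))"
        by (rule sum.cong[OF HOL.refl]) (rule sum.swap)
      finally show ?thesis .
    qed
    moreover have "(\<Sum>vs\<in>?P. exp (- p * M / 2)) / card ?P = exp (- p * M / 2)"
      using P by simp
    ultimately show ?thesis
      unfolding sum.distrib add_divide_distrib sum_distrib_left[symmetric] sum_divide_distrib[symmetric]
      by simp
  qed
  finally have *: "?lhs \<le> (\<Sum>i<M. (\<Sum>vs\<in>?P. ?g (vs ! i)) / card ?P) + exp (- p * M / 2)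
      + 2 / M * (\<Sum>j<M. \<Sum>i<j. (\<Sum>vs\<in>?P. ?h (vs ! i) (vs ! j)) / card ?P)" .
  have "(\<Sum>i<M. (\<Sum>vs\<in>?P. ?g (vs ! i)) / card ?P) = (\<Sum>i<M. ?X / (real n - 1))"
    unfolding L(1)[symmetric] using M n by (intro sum.cong sum_permutations_nth L) auto
  also have "\<dots> \<le> 2 * real M / n * ?X"
  proof -
    have "1 / (real n - 1) \<le> 2 / n" using n by (simp add: field_simps)
    then have "(M * ?X) * (1 / (real n - 1)) \<le> (M * ?X) * (2 / n)"
      using X0 by (intro mult_left_mono) auto
    then show ?thesis by (simp add: mult_ac)
  qed
  finally have X: "(\<Sum>i<M. (\<Sum>vs\<in>?P. ?g (vs ! i)) / card ?P) \<le> 2 * real M / n * ?X" .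
  have "(\<Sum>j<M. \<Sum>i<j. (\<Sum>vs\<in>?P. ?h (vs ! i) (vs ! j)) / card ?P)
    = (\<Sum>j<M. \<Sum>i<j. ?Y / ((real n - 1) * (real n - 1 - 1)))"
    unfolding L(1)[symmetric] using M n by (intro sum.cong sum_permutations_pair) auto
  also have "\<dots> \<le> (\<Sum>j<M. \<Sum>i<M. ?Y / ((real n - 1) * (real n - 1 - 1)))"
    using X0 n by (intro sum_mono sum_mono2) auto
  also have "\<dots> = (real M)\<^sup>2 * (?Y / ((real n - 1) * (real n - 2)))"
    by (simp add: power2_eq_square)
  finally have "2 / M * (\<Sum>j<M. \<Sum>i<j. (\<Sum>vs\<in>?P. ?h (vs ! i) (vs ! j)) / card ?P)
    \<le> 2 / M * ((real M)\<^sup>2 * (?Y / ((real n - 1) * (real n - 2))))"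
    by (rule mult_left_mono) simp
  also have "\<dots> \<le> 12 * real M / (real n)\<^sup>2 * ?Y"
  proof -
    \<comment> \<open>The right-hand side is \<open>6 * (n - 1) * (n - 2) - n\<^sup>2\<close>,
      written so that its sign is visible for \<open>n \<ge> 3\<close>.\<close>
    have "0 \<le> (real n - 3) * (5 * real n - 3) + 3" using n by simp
    then have "(real n)\<^sup>2 \<le> 6 * ((real n - 1) * (real n - 2))"
      by (simp add: power2_eq_square algebra_simps)
    then have "1 / ((real n - 1) * (real n - 2)) \<le> 6 / (real n)\<^sup>2"
      using n by (simp add: divide_simps)
    then have "(2 * M * ?Y) * (1 / ((real n - 1) * (real n - 2))) \<le> (2 * M * ?Y) * (6 / (real n)\<^sup>2)"
      using X0 by (intro mult_left_mono) auto
    then show ?thesis using M by (simp add: power2_eq_square)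
  qed
  finally show ?thesis using * X by linarith
qed

text \<open>Since \<open>edge f\<close> is injective on \<open>{2..n}\<close>, a uniform order of
  the edges is the image of a uniform order of their lower ends; likewise a uniform tree is the
  image of a uniform parent map.\<close>

lemma rrt_largest_fireproof_eq:
  assumes "n \<ge> 1"
  shows "measure_pmf.prob (rrt_largest_fireproof n p) {m..}
    = parent_mean n (\<lambda>f. (\<Sum>vs\<in>permutations_of_set {2..n}.
        measure_pmf.prob (fire_dynamics p (map (edge f) vs) (edge f ` {2..n}) {})
          {F. m \<le> largest_fireproof_size {1..n} (edge f ` {2..n}) F}) / card (permutations_of_set {2..n}))"
proof -
  let ?size = "\<lambda>f F. largest_fireproof_size {1..n} (edge f ` {2..n}) F"
  let ?dyn = "\<lambda>f vs. fire_dynamics p (map (edge f) vs) (edge f ` {2..n}) {}"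
  have perm: "pmf_of_set (permutations_of_set (edge f ` {2..n}))
      = map_pmf (map (edge f)) (pmf_of_set (permutations_of_set {2..n}))" if "f \<in> parent_maps n" for f
  proof -
    have inj: "inj_on (map (edge f)) (permutations_of_set {2..n})"
      by (rule inj_on_mapI) (use inj_on_edge[OF that] in \<open>auto simp: UN_set_permutations_of_set\<close>)
    show ?thesis
      using map_pmf_of_set_inj[OF inj] permutations_of_set_image_inj[OF inj_on_edge[OF that]] by simp
  qed
  have "rrt_largest_fireproof n p = pmf_of_set (parent_maps n) \<bind>
      (\<lambda>f. pmf_of_set (permutations_of_set (edge f ` {2..n})) \<bind>
      (\<lambda>es. map_pmf (?size f) (fire_dynamics p es (edge f ` {2..n}) {})))"
    unfolding rrt_largest_fireproof_def pmf_of_set_recursive_trees[OF assms] bind_map_pmf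
    unfolding map_pmf_def ..
  also have "\<dots> = pmf_of_set (parent_maps n) \<bind>
      (\<lambda>f. pmf_of_set (permutations_of_set {2..n}) \<bind> (\<lambda>vs. map_pmf (?size f) (?dyn f vs)))"
  proof (rule bind_pmf_cong)
    fix f assume "f \<in> set_pmf (pmf_of_set (parent_maps n))"
    then have "f \<in> parent_maps n" by (simp add: finite_parent_maps parent_maps_nonempty)
    from perm[OF this] show "pmf_of_set (permutations_of_set (edge f ` {2..n})) \<bind>
        (\<lambda>es. map_pmf (?size f) (fire_dynamics p es (edge f ` {2..n}) {}))
      = pmf_of_set (permutations_of_set {2..n}) \<bind> (\<lambda>vs. map_pmf (?size f) (?dyn f vs))"
      by (simp add: bind_map_pmf)
  qed simp
  finally show ?thesis
    by (simp add: measure_bind_pmf_expectation parent_mean_eq integral_pmf_of_set vimage_def)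
qed

text \<open>Averaging over the tree replaces the number of large subtrees by
  \<open>5 * n / m\<close> and the number of descendant pairs by \<open>n * ln n\<close>.\<close>

lemma rrt_largest_fireproof_tail:
  fixes m n M :: nat and p :: real
  assumes p: "0 \<le> p" "p \<le> 1" and m: "m > 0" and n: "n \<ge> 3" and M: "M > 0" "M \<le> n - 1"
  shows "measure_pmf.prob (rrt_largest_fireproof n p) {m..}
    \<le> 10 * real M / m + exp (- p * M / 2) + 12 * real M * ln n / n"
proof -
  let ?X = "\<lambda>f. \<Sum>v\<in>{2..n}. of_bool (m \<le> card (subtree f n v)) :: real"
  let ?Y = "\<lambda>f. \<Sum>u\<in>{2..n}. \<Sum>v\<in>{2..n} - {u}. of_bool (desc f u v) :: real"
  have "measure_pmf.prob (rrt_largest_fireproof n p) {m..}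
    \<le> parent_mean n (\<lambda>f. 2 * real M / n * ?X f + exp (- p * M / 2) + 12 * real M / (real n)\<^sup>2 * ?Y f)"
  proof -
    have "n \<ge> 1" using n by simp
    then show ?thesis
      unfolding rrt_largest_fireproof_eq[OF \<open>n \<ge> 1\<close>]
      by (intro parent_mean_mono mean_fire_dynamics_largest assms)
  qed
  also have "\<dots> = 2 * real M / n * parent_mean n ?X + exp (- p * M / 2) + 12 * real M / (real n)\<^sup>2 * parent_mean n ?Y"
    by (simp only: parent_mean_add parent_mean_cmult parent_mean_const)
  also have "\<dots> \<le> 2 * real M / n * (5 * real n / m) + exp (- p * M / 2) + 12 * real M / (real n)\<^sup>2 * (n * ln n)"
    using m n by (intro add_mono mult_left_mono mean_number_large_subtrees mean_number_descendant_pairs order_refl) auto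
  also have "\<dots> = 10 * real M / m + exp (- p * M / 2) + 12 * real M * ln n / n"
    using n m by (simp add: power2_eq_square)
  finally show ?thesis .
qed

section \<open>From the tail bound to tightness\<close>

lemma largest_fireproof_size_le: "largest_fireproof_size {1..n} E F \<le> n"
proof -
  have "card C \<le> n" if "C \<in> fireproof_subtrees {1..n} E F" for C
  proof -
    have "C \<subseteq> {1..n}" using that by (auto simp: fireproof_subtrees_def graph_components_def)
    then show ?thesis using card_mono[of "{1..n}" C] by simp
  qed
  moreover have "finite (fireproof_subtrees {1..n} E F)"
    by (rule finite_subset[of _ "Pow {1..n}"]) (auto simp: fireproof_subtrees_def graph_components_def)
  ultimately show ?thesis by (simp add: largest_fireproof_size_def)
qed

lemma rrt_largest_fireproof_le: "k \<in> set_pmf (rrt_largest_fireproof n p) \<Longrightarrow> k \<le> n"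
  using largest_fireproof_size_le by (auto simp: rrt_largest_fireproof_def simp del: One_nat_def)

theorem corollary2:
  fixes p :: "nat \<Rightarrow> real"
  assumes "\<And>n. n \<ge> 1 \<Longrightarrow> 0 \<le> p n \<and> p n \<le> 1"
    and "p \<longlonglongrightarrow> 0"
    and "filterlim (\<lambda>n. real n * p n / ln (real n)) at_top sequentially"
  shows "tight (\<lambda>k. let n = Suc k in
           distr (measure_pmf (rrt_largest_fireproof n (p n))) borel (\<lambda>f. p n * real f))"
  unfolding tight_def Let_def
proof (intro conjI allI impI)
  fix k
  show "real_distribution (distr (measure_pmf (rrt_largest_fireproof (Suc k) (p (Suc k)))) borel
    (\<lambda>f. p (Suc k) * real f))"
    by (simp add: real_distribution_def real_distribution_axioms_def measure_pmf.prob_space_distr)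
next
  fix \<epsilon> :: real assume \<epsilon>: "\<epsilon> > 0"
  \<comment> \<open>With \<open>M\<close> between \<open>A / p n\<close> and
    \<open>2 * A / p n\<close>, and \<open>m \<ge> K / p n\<close>, the three terms of the tail
    bound are at most \<open>20 * A / K = \<epsilon> / 4\<close>,
    \<open>exp (- A / 2) \<le> \<epsilon> / 4\<close> and
    \<open>24 * A / B \<le> \<epsilon> / 8\<close>. The condition \<open>4 * A \<le> B\<close>
    ensures \<open>M \<le> n - 1\<close>.\<close>
  define A where "A = max 1 (2 * ln (4 / \<epsilon>))"
  define K where "K = 80 * A / \<epsilon>"
  define B where "B = max (4 * A) (192 * A / \<epsilon>)"
  have A: "A \<ge> 1" "exp (- A / 2) \<le> \<epsilon> / 4"
  proof -
    have "2 * ln (4 / \<epsilon>) \<le> A" by (simp add: A_def)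
    moreover have "ln (\<epsilon> / 4) = - ln (4 / \<epsilon>)" using \<epsilon> by (simp add: ln_div)
    ultimately have "- A / 2 \<le> ln (\<epsilon> / 4)" by simp
    then have "exp (- A / 2) \<le> exp (ln (\<epsilon> / 4))" by (subst exp_le_cancel_iff)
    then show "exp (- A / 2) \<le> \<epsilon> / 4" using \<epsilon> by simp
  qed (simp add: A_def)
  have K: "K > 0" using A \<epsilon> by (simp add: K_def)
  have "eventually (\<lambda>n. n \<ge> 3 \<and> B \<le> real n * p n / ln (real n)) sequentially"
    using assms(3) by (intro eventually_conj eventually_ge_at_top) (simp add: filterlim_at_top)
  then obtain N where N: "\<And>n. n \<ge> N \<Longrightarrow> n \<ge> 3 \<and> B \<le> real n * p n / ln (real n)"
    by (auto simp: eventually_sequentially)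
  \<comment> \<open>The bound \<open>N\<close> takes care of the finitely many \<open>n < N\<close>,
    where the size is at most \<open>n\<close> and \<open>p n \<le> 1\<close>; \<open>K\<close>
    serves all other \<open>n\<close>.\<close>
  define b where "b = max K N"
  have tail: "measure_pmf.prob (rrt_largest_fireproof n (p n)) {f. b < p n * real f} < \<epsilon>" if "n \<ge> 1" for n
  proof (cases "n \<ge> N")
    case False
    have "p n * real f \<le> b" if f: "f \<in> set_pmf (rrt_largest_fireproof n (p n))" for f
    proof -
      have "p n * real f \<le> 1 * real N"
        using assms(1)[OF \<open>n \<ge> 1\<close>] rrt_largest_fireproof_le[OF f] False by (intro mult_mono) auto
      then show ?thesis by (simp add: b_def)
    qed
    then have "measure_pmf.prob (rrt_largest_fireproof n (p n)) {f. b < p n * real f} = 0"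
      by (force simp: measure_pmf_zero_iff)
    then show ?thesis using \<epsilon> by simp
  next
    case True
    then have n: "n \<ge> 3" and ratio: "B \<le> real n * p n / ln n" using N by auto
    have q: "0 \<le> p n" "p n \<le> 1" using assms(1)[OF \<open>n \<ge> 1\<close>] by auto
    have "exp 1 \<le> (3 :: real)" by (rule exp_le)
    then have ln: "ln n \<ge> 1" using n by (subst ln_ge_iff) auto
    have B: "B > 0" "4 * A \<le> B" "192 * A / \<epsilon> \<le> B" using A by (auto simp: B_def)
    have pn: "B * ln n \<le> n * p n" using ratio ln by (simp add: field_simps)
    then have "0 < real n * p n" using B ln by (smt (verit) mult_pos_pos)
    then have pos: "p n > 0" using q by (cases "p n = 0") auto
    define M where "M = nat \<lceil>A / p n\<rceil>"
    define m where "m = nat \<lceil>K / p n\<rceil>"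
    have m: "real m \<ge> K / p n" "m > 0" using K pos by (auto simp: m_def)
    have M: "real M \<ge> A / p n" "M > 0" using A pos by (auto simp: M_def)
    \<comment> \<open>As \<open>A \<ge> 1\<close> and \<open>p n \<le> 1\<close>, rounding
      \<open>A / p n\<close> up at most doubles it.\<close>
    have "1 \<le> A / p n" using A q pos by (simp add: field_simps)
    then have M2: "real M \<le> 2 * A / p n" using ceiling_correct[of "A / p n"] M unfolding M_def by simp
    have "B * 1 \<le> B * ln n" using B ln by (intro mult_left_mono) auto
    then have "4 * A \<le> real n * p n" using B pn by linarith
    then have "2 * A / p n \<le> n / 2" using pos by (simp add: field_simps)
    then have Mn: "M \<le> n - 1" using M2 n by linarith
    have "{f. b < p n * real f} \<subseteq> {m..}"
    proof
      fix f assume "f \<in> {f. b < p n * real f}"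
      then have "K < p n * real f" by (simp add: b_def)
      then have "K / p n \<le> real f" using pos by (simp add: field_simps)
      then show "f \<in> {m..}" unfolding m_def by (simp add: nat_le_iff ceiling_le_iff)
    qed
    then have "measure_pmf.prob (rrt_largest_fireproof n (p n)) {f. b < p n * real f}
      \<le> measure_pmf.prob (rrt_largest_fireproof n (p n)) {m..}"
      by (intro measure_pmf.finite_measure_mono) auto
    also have "\<dots> \<le> 10 * real M / m + exp (- p n * M / 2) + 12 * real M * ln n / n"
      by (rule rrt_largest_fireproof_tail) (use q m n M Mn in auto)
    also have "10 * real M / m \<le> 10 * (2 * A / p n) / (K / p n)"
      using M2 m K pos A by (intro frac_le mult_left_mono) auto
    also have "\<dots> = \<epsilon> / 4" using pos A \<epsilon> by (simp add: K_def)
    also have "exp (- p n * M / 2) \<le> exp (- A / 2)"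
      using M(1) pos by (simp add: field_simps)
    also have "\<dots> \<le> \<epsilon> / 4" by (rule A)
    also have "12 * real M * ln n / n \<le> 12 * (2 * A / p n) * ln n / n"
      using M2 ln by (intro divide_right_mono mult_right_mono mult_left_mono) auto
    also have "\<dots> \<le> \<epsilon> / 4"
    proof -
      have "192 * A / \<epsilon> * ln n \<le> B * ln n" using B ln by (intro mult_right_mono) auto
      then have "192 * A / \<epsilon> * ln n \<le> n * p n" using pn by simp
      then have "192 * A * ln n \<le> \<epsilon> * (n * p n)" using \<epsilon> by (simp add: field_simps)
      moreover have "0 \<le> A * ln n" using A ln by simp
      ultimately show ?thesis using pos n by (simp add: field_simps)
    qed
    finally show ?thesis using \<epsilon> by simp
  qed
  \<comment> \<open>The variables are nonnegative and may vanish, so the interval, open on the left,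
    starts at \<open>- 1\<close>.\<close>
  have "1 - \<epsilon> < measure (distr (measure_pmf (rrt_largest_fireproof (Suc k) (p (Suc k)))) borel
      (\<lambda>f. p (Suc k) * real f)) {- 1<..b}" for k
  proof -
    let ?\<mu> = "rrt_largest_fireproof (Suc k) (p (Suc k))"
    have "0 \<le> p (Suc k)" using assms(1)[of "Suc k"] by simp
    then have "- 1 < p (Suc k) * real f" for f
      using mult_nonneg_nonneg[of "p (Suc k)" "real f"] by linarith
    then have "(\<lambda>f. p (Suc k) * real f) -` {- 1<..b} = - {f. b < p (Suc k) * real f}" by auto
    then show ?thesis
      using tail[of "Suc k"] measure_pmf.prob_compl[of "{f. b < p (Suc k) * real f}" ?\<mu>]
      by (simp add: measure_distr Compl_eq_Diff_UNIV)
  qed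
  moreover have "- 1 < b" using K by (simp add: b_def)
  ultimately show "\<exists>a b. a < b \<and> (\<forall>k. 1 - \<epsilon> < measure (distr (measure_pmf
      (rrt_largest_fireproof (Suc k) (p (Suc k)))) borel (\<lambda>f. p (Suc k) * real f)) {a<..b})"
    by blast
qed

end
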